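(* Let $k\ge 1$ and $m\ge 1$ be integers, $n=2k+1$, $N=n+m$. For every $\varepsilon\in(0,1)$, let $$W=\left\{(x,y)\in\mathbb{R}^n\times\mathbb{R}^m : (x_1^2+\dots+x_n^2-1)^2+(y_1^2+\dots+y_m^2)\le \varepsilon^2\right\},$$ and let $C(\varepsilon)$ be the volume of $W$. Then there is a polynomial $P$ in two variables $a,b$, of degree $2k-1$, containing only monomials of even degree in $a$ and odd degree in $b$, such that for all hyperplanes $$\alpha_1x_1+\dots+\alpha_nx_n+\gamma_1y_1+\dots+\gamma_my_m=\beta$$ in some neighborhood (in the space $\mathcal{P}$ of affine hyperplanes of $\mathbb{R}^N$) of the set of hyperplanes containing the coordinate subspace $\mathbb{R}^m=\{0\}\times\mathbb{R}^m$, the two values of the volume function $V_W$ are $$\frac{C(\varepsilon)}{2}\pm P\bigl(a(\alpha,\gamma),\,b(\alpha,\beta)\bigr),\qquad a(\alpha,\gamma)=\frac{\sqrt{\gamma_1^2+\dots+\gamma_m^2}}{\sqrt{\alpha_1^2+\dots+\alpha_n^2}},\quad b(\alpha,\beta)=\frac{|\beta|}{\sqrt{\alpha_1^2+\dots+\alpha_n^2}}.$$ In particular, $V_W$ coincides in this neighborhood with an algebraic function of the variables $\alpha_i,\gamma_j$ and $\beta$.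
   Context: The coordinates $x_1,\dots,x_n$ and $y_1,\dots,y_m$ are the standard coordinates in the Euclidean spaces $\mathbb{R}^n$ and $\mathbb{R}^m$, and $\mathbb{R}^N=\mathbb{R}^n\times\mathbb{R}^m$. $\mathcal{P}$ is the space of all affine hyperplanes in $\mathbb{R}^N$. The volume function $V_W$ is the two-valued function on $\mathcal{P}$ whose values at a hyperplane are the volumes of the two parts into which this hyperplane cuts $W$ (the intersections of $W$ with the two half-spaces bounded by the hyperplane). That $V_W$ coincides with an algebraic function in a domain of $\mathcal{P}$ means that there is a non-trivial (non-zero) polynomial in $N+2$ variables vanishing on every tuple $(V,\alpha_1,\dots,\alpha_n,\gamma_1,\dots,\gamma_m,\beta)$ where the equation $\sum\alpha_ix_i+\sum\gamma_jy_j=\beta$ defines a hyperplane from this domain and $V$ is one of the two volumes cut from $W$ by this hyperplane. Hyperplanes containing $\{0\}\times\mathbb{R}^m$ are those with all $\gamma_j=0$ and $\beta=0$; the neighborhood consists of hyperplanes for which not all $\alpha_i$ vanish. The polynomial $P$ may depend on $\varepsilon$, $k$ and $m$. *)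

theory Defs
  imports "HOL-Analysis.Analysis" "HOL-Library.Poly_Mapping"
begin

section \<open>Real polynomials in several variables\<close>

text \<open>A polynomial with variables indexed by \<open>'v\<close> maps each monomial
  (a finitely supported exponent function) to its coefficient.\<close>

type_synonym 'v mpolynomial = "('v \<Rightarrow>\<^sub>0 nat) \<Rightarrow>\<^sub>0 real"

definition mono_degree :: "('v \<Rightarrow>\<^sub>0 nat) \<Rightarrow> nat" where
  "mono_degree e = (\<Sum>v\<in>Poly_Mapping.keys e. Poly_Mapping.lookup e v)"

text \<open>The zero polynomial gets total degree 0.\<close>

definition total_degree :: "'v mpolynomial \<Rightarrow> nat" where
  "total_degree p = Max (insert 0 (mono_degree ` Poly_Mapping.keys p))"

definition mpoly_eval :: "('v \<Rightarrow> real) \<Rightarrow> 'v mpolynomial \<Rightarrow> real" where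
  "mpoly_eval f p = (\<Sum>e\<in>Poly_Mapping.keys p. Poly_Mapping.lookup p e * (\<Prod>v\<in>Poly_Mapping.keys e. f v ^ Poly_Mapping.lookup e v))"

section \<open>The space of affine hyperplanes\<close>

definition hyperplane :: "'a::euclidean_space \<Rightarrow> real \<Rightarrow> 'a set" where
  "hyperplane c b = {z. c \<bullet> z = b}"

definition hyperplanes :: "'a::euclidean_space set set" where
  "hyperplanes = {hyperplane c b | c b. c \<noteq> 0}"

text \<open>The topology is the quotient of the space of all \<open>(c, b)\<close> with \<open>c \<noteq> 0\<close>
  under \<open>(c, b) \<mapsto> hyperplane c b\<close>, i.e. modulo nonzero scalars.\<close>

definition hyperplane_topology :: "'a::euclidean_space set topology" where
  "hyperplane_topology =
     topology (\<lambda>U. U \<subseteq> hyperplanes \<and> open {(c, b). c \<noteq> 0 \<and> hyperplane c b \<in> U})"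

lemma openin_hyperplane_topology:
  "openin hyperplane_topology U \<longleftrightarrow>
     U \<subseteq> hyperplanes \<and> open {(c, b). c \<noteq> 0 \<and> hyperplane c b \<in> U}"
proof -
  let ?pre = "\<lambda>U :: 'a set set. {(c, b). c \<noteq> 0 \<and> hyperplane c b \<in> U}"
  have "istopology (\<lambda>U. U \<subseteq> hyperplanes \<and> open (?pre U))"
    unfolding istopology_def
  proof (intro conjI allI impI)
    fix S T assume "S \<subseteq> hyperplanes \<and> open (?pre S)" "T \<subseteq> hyperplanes \<and> open (?pre T)"
    moreover have "?pre (S \<inter> T) = ?pre S \<inter> ?pre T" by auto
    ultimately show "S \<inter> T \<subseteq> hyperplanes" "open (?pre (S \<inter> T))" by auto
  next
    fix K assume "\<forall>U\<in>K. U \<subseteq> hyperplanes \<and> open (?pre U)"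
    moreover have "?pre (\<Union>K) = (\<Union>U\<in>K. ?pre U)" by auto
    ultimately show "\<Union>K \<subseteq> hyperplanes" "open (?pre (\<Union>K))" by auto
  qed
  then show ?thesis
    unfolding hyperplane_topology_def by (simp add: topology_inverse')
qed

section \<open>The volume function\<close>

text \<open>The set of values of the two-valued volume function of \<open>W\<close> at the hyperplane \<open>H\<close>.
  Since \<open>(- c, - b)\<close> represents the same hyperplane as \<open>(c, b)\<close>, both
  half-spaces bounded by \<open>H\<close> occur.\<close>

definition volume_values :: "'a::euclidean_space set \<Rightarrow> 'a set \<Rightarrow> real set" where
  "volume_values W H =
     {measure lebesgue (W \<inter> {z. c \<bullet> z \<le> b}) | c b. c \<noteq> 0 \<and> H = hyperplane c b}"

lemma hyperplane_eq_imp_scaled: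
  assumes c: "c \<noteq> 0" and c': "c' \<noteq> 0" and eq: "hyperplane c b = hyperplane c' b'"
  obtains t where "t \<noteq> 0" "c' = t *\<^sub>R c" "b' = t * b"
proof -
  define z where "z = (b / (c \<bullet> c)) *\<^sub>R c"
  define t where "t = (c \<bullet> c') / (c \<bullet> c)"
  define w where "w = c' - t *\<^sub>R c"
  have cc: "c \<bullet> c \<noteq> 0" using c by simp
  have z: "c \<bullet> z = b" using cc by (simp add: z_def)
  have w: "c \<bullet> w = 0" using cc by (simp add: w_def t_def inner_diff_right)
  have "z \<in> hyperplane c b" "z + w \<in> hyperplane c b"
    using z w by (simp_all add: hyperplane_def inner_add_right)
  then have z': "c' \<bullet> z = b'" and "c' \<bullet> (z + w) = b'"
    unfolding eq by (simp_all add: hyperplane_def)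
  then have "c' \<bullet> w = 0" by (simp add: inner_add_right)
  then have "w \<bullet> w = 0"
    using w by (simp add: w_def inner_diff_left)
  then have ct: "c' = t *\<^sub>R c" by (simp add: w_def)
  moreover have "t \<noteq> 0" using ct c' by auto
  moreover have "b' = t * b" using z z' ct by auto
  ultimately show thesis using that by blast
qed

lemma volume_values_hyperplane:
  assumes c: "c \<noteq> 0"
  shows "volume_values W (hyperplane c b) =
    {measure lebesgue (W \<inter> {z. c \<bullet> z \<le> b}), measure lebesgue (W \<inter> {z. c \<bullet> z \<ge> b})}"
    (is "?L = {?v, ?w}")
proof
  show "?L \<subseteq> {?v, ?w}"
  proof
    fix v assume "v \<in> ?L"
    then obtain c' b' where v: "v = measure lebesgue (W \<inter> {z. c' \<bullet> z \<le> b'})"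
      and c': "c' \<noteq> 0" and eq: "hyperplane c b = hyperplane c' b'"
      unfolding volume_values_def by blast
    obtain t where t: "t \<noteq> 0" "c' = t *\<^sub>R c" "b' = t * b"
      using hyperplane_eq_imp_scaled[OF c c' eq] .
    show "v \<in> {?v, ?w}"
    proof (cases "t > 0")
      case True
      then have "{z. c' \<bullet> z \<le> b'} = {z. c \<bullet> z \<le> b}" using t by simp
      then show ?thesis using v by simp
    next
      case False
      then have "{z. c' \<bullet> z \<le> b'} = {z. c \<bullet> z \<ge> b}" using t by simp
      then show ?thesis using v by simp
    qed
  qed
  have "?v \<in> ?L" unfolding volume_values_def using c by blast
  moreover have "?w \<in> ?L"
  proof -
    have "{z. c \<bullet> z \<ge> b} = {z. (- c) \<bullet> z \<le> - b}" by simp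
    moreover have "hyperplane c b = hyperplane (- c) (- b)" by (simp add: hyperplane_def)
    ultimately show ?thesis
      unfolding volume_values_def mem_Collect_eq using c
      by (intro exI[of _ "- c"] exI[of _ "- b"]) simp
  qed
  ultimately show "{?v, ?w} \<subseteq> ?L" by blast
qed

section \<open>Algebraicity of the volume function\<close>

text \<open>The \<open>N + 2\<close> variables \<open>V\<close>, \<open>\<alpha>\<^sub>i\<close>, \<open>\<gamma>\<^sub>j\<close>, \<open>\<beta>\<close>.\<close>

datatype ('n, 'm) hyp_var = VarV | VarAlpha 'n | VarGamma 'm | VarBeta

definition volume_algebraic_on ::
    "((real^'n) \<times> (real^'m)) set \<Rightarrow> ((real^'n) \<times> (real^'m)) set set \<Rightarrow> bool" where
  "volume_algebraic_on W U \<longleftrightarrow>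
     (\<exists>Q :: ('n, 'm) hyp_var mpolynomial. Q \<noteq> 0 \<and>
        (\<forall>\<alpha> \<gamma> \<beta> v. (\<alpha>, \<gamma>) \<noteq> 0 \<longrightarrow> hyperplane (\<alpha>, \<gamma>) \<beta> \<in> U \<longrightarrow>
           v \<in> volume_values W (hyperplane (\<alpha>, \<gamma>) \<beta>) \<longrightarrow>
           mpoly_eval (case_hyp_var v (\<lambda>i. \<alpha> $ i) (\<lambda>j. \<gamma> $ j) \<beta>) Q = 0))"

datatype ab_var = VarA | VarB

end

(* For fixed y the slice of W is the shell 1 - s <= |x|^2 <= 1 + s with s = sqrt (eps^2 - |y|^2).
   In odd dimension 2k + 1 the hyperplane sections of a ball have volume c (r^2 - t^2)^k, so a
   half-space at a height t below the inner radius cuts from the shell half of its volume plus an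
   odd polynomial in t of degree 2k - 1 (the two terms t^(2k+1) cancel).  Substituting
   t = beta - gamma . y and integrating over |y| <= eps, odd powers of gamma . y vanish by symmetry,
   and by rotation invariance the even ones give |gamma|^(2i) times a constant.
   The coefficient of b^(2k-1) is a nonzero multiple of the integral of s. *)
theory Submission
  imports Defs
begin

section \<open>Invariance of Lebesgue measure under orthogonal transformations\<close>

text \<open>An even n would leave odd powers of a square root in the section volumes. For n = 2k + 1
  these volumes are polynomials in t and r^2, and the top coefficient of their antiderivative, at
  t^(2k+1), does not involve r^2; this is the source of the cancellation. The obstacle is that the
  polynomial formula for a slice holds only while the cut stays within its inner radius, and this
  must hold for all |y| <= eps at once. Since s <= eps, the inner radii are at least sqrt (1 - eps),
  while |beta - gamma . y| <= |beta| + eps |gamma|. Comparing the two bounds dictates the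
  neighborhood. The surviving moments are taken against one fixed unit vector, so they are
  constants. Each (beta - gamma . y)^(2l+1) is homogeneous in beta and gamma, which gives the degree
  of P. The choice between the two volumes disappears in (V - C/2)^2 = P^2, from which algebraicity
  follows.\<close>

lemma measurable_orthogonal_transformation:
  fixes f :: "'a::euclidean_space \<Rightarrow> 'a"
  assumes "orthogonal_transformation f"
  shows "f \<in> borel_measurable borel"
  using assms by (intro borel_measurable_continuous_onI linear_continuous_on)
    (simp add: linear_conv_bounded_linear[symmetric] orthogonal_transformation_linear)

lemma orthogonal_transformation_vimage_ball:
  fixes f :: "'a::euclidean_space \<Rightarrow> 'a"
  assumes f: "orthogonal_transformation f"
  shows "f -` ball x r = ball (inv f x) r"
proof -
  have bij: "bij f" by (rule orthogonal_transformation_bij[OF f])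
  have "dist x (f z) = dist (inv f x) z" for z
  proof -
    have "dist x (f z) = norm (f (inv f x) - f z)"
      using bij by (simp add: dist_norm bij_is_surj surj_f_inv_f)
    also have "\<dots> = norm (inv f x - z)"
      using linear_diff[OF orthogonal_transformation_linear[OF f], symmetric]
      by (simp add: orthogonal_transformation_norm[OF f])
    finally show ?thesis by (simp add: dist_norm)
  qed
  then show ?thesis by (auto simp: ball_def)
qed

text \<open>By Vitali's covering theorem an open set is, up to a null set, a countable disjoint union
  of balls, and orthogonal transformations preserve the volume of balls.\<close>

lemma emeasure_lborel_open_le_vimage:
  fixes f :: "'a::euclidean_space \<Rightarrow> 'a"
  assumes f: "orthogonal_transformation f" and U: "open U"
  shows "emeasure lborel U \<le> emeasure lborel (f -` U)"
proof -
  have fm [measurable]: "f \<in> borel_measurable borel"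
    by (rule measurable_orthogonal_transformation[OF f])
  define K where "K = {(x::'a, r::real). 0 < r \<and> ball x r \<subseteq> U}"
  define B where "B = (\<lambda>i::'a \<times> real. ball (fst i) (snd i))"
  \<comment> \<open>Fineness of the cover, as Vitali's theorem demands: each point of
    \<open>U\<close> lies in arbitrarily small balls of the family.\<close>
  have "\<exists>i. i \<in> K \<and> x \<in> ball (fst i) (snd i) \<and> snd i < d" if "x \<in> U" "0 < d" for x d
  proof -
    obtain e where e: "e > 0" "ball x e \<subseteq> U" using U \<open>x \<in> U\<close> by (meson openE)
    define r where "r = min e (d / 2)"
    have "ball x r \<subseteq> ball x e" by (simp add: r_def subset_ball)
    then have "(x, r) \<in> K" using e \<open>0 < d\<close> by (auto simp: K_def r_def)
    then show ?thesis using e \<open>0 < d\<close> by (intro exI[of _ "(x, r)"]) (auto simp: r_def)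
  qed
  then obtain C where C: "countable C" "C \<subseteq> K"
      and disj: "pairwise (\<lambda>i j. disjnt (ball (fst i) (snd i)) (ball (fst j) (snd j))) C"
      and neg: "negligible (U - (\<Union>i\<in>C. ball (fst i) (snd i)))"
    by (rule Vitali_covering_theorem_balls[of U K fst snd])
  have sub: "(\<Union>i\<in>C. B i) \<subseteq> U" using C(2) unfolding K_def B_def by fastforce
  have df: "disjoint_family_on B C"
    using disj by (auto simp: disjoint_family_on_def pairwise_def disjnt_def B_def)
  have df': "disjoint_family_on (\<lambda>i. f -` B i) C"
    using df unfolding disjoint_family_on_def by blast
  have Bo: "open (\<Union>i\<in>C. B i)" by (auto simp: B_def)
  have null: "U - (\<Union>i\<in>C. B i) \<in> null_sets lborel"
    using neg U Bo by (simp add: negligible_iff_null_sets null_sets_completion_iff B_def)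
  have Bm: "B i \<in> sets lborel" for i by (simp add: B_def)
  have fB: "f -` B i \<in> sets lborel" for i
    using measurable_sets_borel[OF fm, of "B i"] by (simp add: B_def)
  have eq: "emeasure lborel (f -` B i) = emeasure lborel (B i)" if "i \<in> C" for i
    using that C(2) by (auto simp: K_def B_def orthogonal_transformation_vimage_ball[OF f] emeasure_ball)
  have "U = (\<Union>i\<in>C. B i) \<union> (U - (\<Union>i\<in>C. B i))" using sub by auto
  then have "emeasure lborel U = emeasure lborel ((\<Union>i\<in>C. B i) \<union> (U - (\<Union>i\<in>C. B i)))" by simp
  also have "\<dots> = emeasure lborel (\<Union>i\<in>C. B i)"
    using Bo null by (intro emeasure_Un_null_set) auto
  also have "\<dots> = (\<integral>\<^sup>+i. emeasure lborel (B i) \<partial>count_space C)"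
    using C(1) df Bm by (intro emeasure_UN_countable) auto
  also have "\<dots> = (\<integral>\<^sup>+i. emeasure lborel (f -` B i) \<partial>count_space C)"
    by (intro nn_integral_cong) (simp add: eq)
  also have "\<dots> = emeasure lborel (\<Union>i\<in>C. f -` B i)"
    using C(1) df' fB by (intro emeasure_UN_countable[symmetric]) auto
  also have "\<dots> \<le> emeasure lborel (f -` U)"
    using sub measurable_sets_borel[OF fm, of U] U by (intro emeasure_mono) auto
  finally show ?thesis .
qed

text \<open>The inequality for open sets, applied to \<open>f\<close> and to its inverse, becomes an
  equality on boxes, and boxes determine \<open>lborel\<close>.\<close>

lemma lborel_distr_orthogonal_transformation:
  fixes f :: "'a::euclidean_space \<Rightarrow> 'a"
  assumes f: "orthogonal_transformation f"
  shows "distr lborel lborel f = lborel"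
proof (rule lborel_eqI[symmetric])
  have fm: "f \<in> borel_measurable borel"
    by (rule measurable_orthogonal_transformation[OF f])
  have g: "orthogonal_transformation (inv f)" by (rule orthogonal_transformation_inv[OF f])
  have vim: "inv f -` (f -` U) = U" for U
    using orthogonal_transformation_bij[OF f] by (auto simp: bij_is_surj surj_f_inv_f)
  fix l u :: 'a assume le: "\<And>b. b \<in> Basis \<Longrightarrow> l \<bullet> b \<le> u \<bullet> b"
  have "open (f -` box l u)"
    using f by (intro open_vimage linear_continuous_on)
      (auto simp: linear_conv_bounded_linear[symmetric] orthogonal_transformation_linear open_box)
  then have "emeasure lborel (f -` box l u) \<le> emeasure lborel (box l u)"
    using emeasure_lborel_open_le_vimage[OF g, of "f -` box l u"] by (simp add: vim)
  moreover have "emeasure lborel (box l u) \<le> emeasure lborel (f -` box l u)"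
    by (rule emeasure_lborel_open_le_vimage[OF f open_box])
  ultimately have "emeasure lborel (f -` box l u) = emeasure lborel (box l u)" by simp
  then show "emeasure (distr lborel lborel f) (box l u) = (\<Prod>b\<in>Basis. (u - l) \<bullet> b)"
    using fm le by (simp add: emeasure_distr emeasure_lborel_box)
qed simp

lemma measure_lborel_orthogonal_vimage:
  fixes f :: "'a::euclidean_space \<Rightarrow> 'a"
  assumes f: "orthogonal_transformation f" and S: "S \<in> sets borel"
  shows "measure lborel (f -` S) = measure lborel S"
proof -
  have "measure lborel S = measure (distr lborel lborel f) S"
    by (simp add: lborel_distr_orthogonal_transformation[OF f])
  also have "\<dots> = measure lborel (f -` S)"
    using S measurable_orthogonal_transformation[OF f] by (subst measure_distr) auto
  finally show ?thesis by simp
qed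

lemma integral_lborel_orthogonal_transformation:
  fixes f :: "'a::euclidean_space \<Rightarrow> 'a" and h :: "'a \<Rightarrow> real"
  assumes f: "orthogonal_transformation f" and h: "h \<in> borel_measurable borel"
  shows "(LINT x|lborel. h (f x)) = (LINT x|lborel. h x)"
proof -
  have "(LINT x|lborel. h x) = (LINT x|distr lborel lborel f. h x)"
    by (simp add: lborel_distr_orthogonal_transformation[OF f])
  also have "\<dots> = (LINT x|lborel. h (f x))"
    using h measurable_orthogonal_transformation[OF f] by (intro integral_distr) auto
  finally show ?thesis by simp
qed

section \<open>Balls and spherical shells cut by a hyperplane\<close>

text \<open>Fubini with the coordinate along \<open>e\<close> split off: the slice at height t is a
  ball of radius sqrt (r^2 - t^2) in the remaining coordinates. The strict bounds on
  \<open>a\<close> and \<open>b\<close> keep this radius positive, as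
  \<open>emeasure_cball_aux\<close> requires.\<close>

lemma emeasure_cball_slab:
  fixes e :: "'a::euclidean_space" and a b r :: real
  assumes e: "e \<in> Basis" and ab: "- r < a" "b < r"
  shows "emeasure lborel {x::'a. norm x \<le> r \<and> x \<bullet> e \<in> {a..b}} =
    (\<integral>\<^sup>+t. ennreal (unit_ball_vol (real (DIM('a) - 1)) * sqrt (r\<^sup>2 - t\<^sup>2) ^ (DIM('a) - 1)) *
       indicator {a..b} t \<partial>lborel)"
proof (cases "r > 0")
  case False
  then have "{a..b} = {}" using ab by auto
  then show ?thesis by simp
next
  case r: True
  interpret product_sigma_finite "\<lambda>_. lborel" by standard
  define A where "A = (Basis::'a set) - {e}"
  have A: "finite A" "e \<notin> A" "insert e A = Basis" "card A = DIM('a) - 1"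
    using e by (auto simp: A_def card_Diff_singleton)
  let ?M = "\<lambda>I::'a set. Pi\<^sub>M I (\<lambda>_. lborel :: real measure)"
  define S where "S = {x::'a. norm x \<le> r \<and> x \<bullet> e \<in> {a..b}}"
  have S [measurable]: "S \<in> sets borel"
  proof -
    have "S = cball 0 r \<inter> {x. a \<le> x \<bullet> e} \<inter> {x. x \<bullet> e \<le> b}" by (auto simp: S_def)
    then show ?thesis
      by (auto intro!: borel_closed closed_Int closed_Collect_le continuous_intros)
  qed
  \<comment> \<open>\<open>S\<close> in coordinates, as a set of functions on the basis, where the
    product measure can be split at \<open>e\<close>.\<close>
  define T where "T = {f::'a \<Rightarrow> real. sqrt ((f e)\<^sup>2 + (\<Sum>i\<in>A. (f i)\<^sup>2)) \<le> r \<and> f e \<in> {a..b}} \<inter> space (?M (insert e A))"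
  have T [measurable]: "T \<in> sets (?M (insert e A))"
    unfolding T_def Collect_conj_eq by measurable
  have "emeasure lborel S = emeasure (distr (?M Basis) borel (\<lambda>f. \<Sum>b\<in>Basis. f b *\<^sub>R b)) S"
    by (subst lborel_eq) simp
  also have "\<dots> = emeasure (?M Basis) ({f. (\<Sum>b\<in>Basis. f b *\<^sub>R b) \<in> S} \<inter> space (?M Basis))"
    by (subst emeasure_distr) (auto simp: vimage_def)
  also have "{f. (\<Sum>b\<in>Basis. f b *\<^sub>R b) \<in> S} \<inter> space (?M Basis) = T"
  proof -
    have "norm (\<Sum>b\<in>Basis. f b *\<^sub>R b :: 'a) = sqrt ((f e)\<^sup>2 + (\<Sum>i\<in>A. (f i)\<^sup>2))" for f :: "'a \<Rightarrow> real"
    proof -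
      have "norm (\<Sum>b\<in>Basis. f b *\<^sub>R b :: 'a) = sqrt (\<Sum>i\<in>Basis. (f i)\<^sup>2)"
        using euclidean_dist_l2[of 0 "\<Sum>b\<in>Basis. f b *\<^sub>R b :: 'a"] by (simp add: L2_set_def)
      also have "(\<Sum>i\<in>Basis. (f i)\<^sup>2) = (\<Sum>i\<in>insert e A. (f i)\<^sup>2)" by (simp add: A)
      finally show ?thesis using A(1,2) by simp
    qed
    then show ?thesis using e by (auto simp: S_def T_def A(3))
  qed
  also have "emeasure (?M Basis) T = (\<integral>\<^sup>+f. indicator T f \<partial>?M (insert e A))"
    using T by (simp add: A(3))
  also have "\<dots> = (\<integral>\<^sup>+t. \<integral>\<^sup>+f. indicator T (f(e := t)) \<partial>?M A \<partial>lborel)"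
    using A(1,2) by (intro product_nn_integral_insert_rev) auto
  also have "\<dots> = (\<integral>\<^sup>+t. ennreal (unit_ball_vol (real (DIM('a) - 1)) * sqrt (r\<^sup>2 - t\<^sup>2) ^ (DIM('a) - 1)) *
       indicator {a..b} t \<partial>lborel)"
  proof (intro nn_integral_cong)
    fix t :: real
    show "(\<integral>\<^sup>+f. indicator T (f(e := t)) \<partial>?M A) =
      ennreal (unit_ball_vol (real (DIM('a) - 1)) * sqrt (r\<^sup>2 - t\<^sup>2) ^ (DIM('a) - 1)) * indicator {a..b} t"
    proof (cases "t \<in> {a..b}")
      case False
      then have "(\<integral>\<^sup>+f. indicator T (f(e := t)) \<partial>?M A) = (\<integral>\<^sup>+f. 0 \<partial>?M A)"
        by (intro nn_integral_cong) (auto simp: T_def)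
      with False show ?thesis by simp
    next
      case True
      then have "\<bar>t\<bar> < r" using ab by auto
      then have tr: "t\<^sup>2 < r\<^sup>2" using abs_square_less_1[of "t / r"] r by (simp add: power_divide)
      define R where "R = sqrt (r\<^sup>2 - t\<^sup>2)"
      have R: "R > 0" "R\<^sup>2 = r\<^sup>2 - t\<^sup>2" using tr by (simp_all add: R_def)
      have "f(e := t) \<in> T \<longleftrightarrow> f \<in> {f. sqrt (\<Sum>i\<in>A. (f i)\<^sup>2) \<le> R}" if f: "f \<in> space (?M A)" for f
      proof -
        have s: "(\<Sum>i\<in>A. ((f(e := t)) i)\<^sup>2) = (\<Sum>i\<in>A. (f i)\<^sup>2)"
          using A by (intro sum.cong) auto
        have sp: "f(e := t) \<in> space (?M (insert e A))"
          using f by (auto simp: space_PiM PiE_def extensional_def)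
        have "f(e := t) \<in> T \<longleftrightarrow> sqrt (t\<^sup>2 + (\<Sum>i\<in>A. (f i)\<^sup>2)) \<le> r"
          using True sp s by (simp add: T_def)
        also have "\<dots> \<longleftrightarrow> t\<^sup>2 + (\<Sum>i\<in>A. (f i)\<^sup>2) \<le> r\<^sup>2"
          using r by (intro real_sqrt_le_iff') (auto simp: sum_nonneg)
        also have "\<dots> \<longleftrightarrow> (\<Sum>i\<in>A. (f i)\<^sup>2) \<le> R\<^sup>2" by (auto simp: R)
        also have "\<dots> \<longleftrightarrow> sqrt (\<Sum>i\<in>A. (f i)\<^sup>2) \<le> R"
          using R(1) by (intro real_sqrt_le_iff'[symmetric]) (auto simp: sum_nonneg)
        finally show ?thesis by simp
      qed
      then have "(\<integral>\<^sup>+f. indicator T (f(e := t)) \<partial>?M A) =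
        (\<integral>\<^sup>+f. indicator ({f. sqrt (\<Sum>i\<in>A. (f i)\<^sup>2) \<le> R} \<inter> space (?M A)) f \<partial>?M A)"
        by (intro nn_integral_cong) (simp add: indicator_def)
      also have "\<dots> = emeasure (?M A) ({f. sqrt (\<Sum>i\<in>A. (f i)\<^sup>2) \<le> R} \<inter> space (?M A))"
        using A(1) by (intro nn_integral_indicator) measurable
      also have "\<dots> = ennreal (unit_ball_vol (real (card A)) * R ^ card A)"
        by (rule emeasure_cball_aux[OF A(1) R(1)])
      finally show ?thesis using True by (simp add: A(4) R_def)
    qed
  qed
  finally show ?thesis by (simp only: S_def)
qed

text \<open>The odd antiderivative in \<open>t\<close> of \<open>(q - t\<^sup>2) ^ k\<close>. Up to the volume of the unit ball, that power is
  the volume of the section at height \<open>t\<close> of the \<open>(2 * k + 1)\<close>-dimensional ball of radius \<open>sqrt q\<close>.\<close>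

definition cap_poly :: "nat \<Rightarrow> real \<Rightarrow> real \<Rightarrow> real" where
  "cap_poly k q t = (\<Sum>l\<le>k. real (k choose l) * (- 1) ^ l * q ^ (k - l) * t ^ (2 * l + 1) / real (2 * l + 1))"

lemma cap_poly_uminus: "cap_poly k q (- t) = - cap_poly k q t"
  by (simp add: cap_poly_def sum_negf[symmetric] power_minus_odd del: power_Suc)

lemma cap_poly_has_derivative: "(cap_poly k q has_real_derivative (q - t\<^sup>2) ^ k) (at t)"
proof -
  have "(cap_poly k q has_real_derivative
      (\<Sum>l\<le>k. real (k choose l) * (- 1) ^ l * q ^ (k - l) * t ^ (2 * l))) (at t)"
    unfolding cap_poly_def[abs_def]
  proof (intro DERIV_sum)
    fix l
    have "((\<lambda>t. t ^ (2 * l + 1)) has_real_derivative real (2 * l + 1) * t ^ (2 * l)) (at t)"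
      using DERIV_pow[of "2 * l + 1" t] by simp
    from DERIV_cmult[OF this, of "real (k choose l) * (- 1) ^ l * q ^ (k - l) / real (2 * l + 1)"]
    show "((\<lambda>t. real (k choose l) * (- 1) ^ l * q ^ (k - l) * t ^ (2 * l + 1) / real (2 * l + 1))
      has_real_derivative real (k choose l) * (- 1) ^ l * q ^ (k - l) * t ^ (2 * l)) (at t)"
      by (simp add: mult_ac del: power_Suc of_nat_Suc of_nat_add)
  qed
  also have "(\<Sum>l\<le>k. real (k choose l) * (- 1) ^ l * q ^ (k - l) * t ^ (2 * l)) = (- (t\<^sup>2) + q) ^ k"
    unfolding binomial_ring
    by (intro sum.cong refl) (simp add: power_minus[of "t\<^sup>2"] power_mult[symmetric] mult_ac)
  finally show ?thesis by simp
qed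

lemma measurable_cball_slab [measurable]:
  fixes u :: "'a::euclidean_space"
  shows "{x::'a. norm x \<le> r \<and> x \<bullet> u \<in> {a..b}} \<in> sets borel"
    "{x::'a. norm x \<le> r \<and> b \<le> x \<bullet> u} \<in> sets borel"
  by simp_all

text \<open>A rotation takes \<open>u\<close> to a basis vector. On the slab t^2 <= r^2, so the even
  power \<open>2 * k\<close> removes the square root and the fundamental theorem of calculus applies
  to \<open>cap_poly\<close>.\<close>

lemma measure_cball_slab:
  fixes u :: "real^'n"
  assumes n: "CARD('n) = 2 * k + 1" and u: "norm u = 1" and ab: "- r < a" "a \<le> b" "b < r"
  shows "measure lborel {x. norm x \<le> r \<and> x \<bullet> u \<in> {a..b}} =
    unit_ball_vol (real (2 * k)) * (cap_poly k (r\<^sup>2) b - cap_poly k (r\<^sup>2) a)"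
proof -
  define e :: "real^'n" where "e = axis undefined 1"
  have e: "e \<in> Basis" by (simp add: e_def axis_in_Basis_iff)
  then have "norm e = norm u" using u by simp
  then obtain f where f: "orthogonal_transformation f" and fe: "f u = e"
    using orthogonal_transformation_exists[of u e] by metis
  define c where "c = unit_ball_vol (real (2 * k))"
  have c: "c \<ge> 0" by (simp add: c_def)
  have "{x. norm x \<le> r \<and> x \<bullet> u \<in> {a..b}} = f -` {x. norm x \<le> r \<and> x \<bullet> e \<in> {a..b}}"
    using f by (auto simp: fe[symmetric] orthogonal_transformation_norm orthogonal_transformation_def)
  then have rotate: "measure lborel {x. norm x \<le> r \<and> x \<bullet> u \<in> {a..b}} = measure lborel {x. norm x \<le> r \<and> x \<bullet> e \<in> {a..b}}"
    using measure_lborel_orthogonal_vimage[OF f measurable_cball_slab(1)[of r e a b]] by simp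
  have "emeasure lborel {x. norm x \<le> r \<and> x \<bullet> e \<in> {a..b}} =
      (\<integral>\<^sup>+t. ennreal (c * sqrt (r\<^sup>2 - t\<^sup>2) ^ (2 * k)) * indicator {a..b} t \<partial>lborel)"
    using emeasure_cball_slab[OF e ab(1,3)] by (simp add: n c_def)
  also have "\<dots> = (\<integral>\<^sup>+t. ennreal (c * (r\<^sup>2 - t\<^sup>2) ^ k) * indicator {a..b} t \<partial>lborel)"
  proof (intro nn_integral_cong)
    fix t :: real
    have "t\<^sup>2 \<le> r\<^sup>2" if "t \<in> {a..b}"
      using that ab by (intro abs_le_square_iff[THEN iffD1]) auto
    then show "ennreal (c * sqrt (r\<^sup>2 - t\<^sup>2) ^ (2 * k)) * indicator {a..b} t =
        ennreal (c * (r\<^sup>2 - t\<^sup>2) ^ k) * indicator {a..b} t"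
      by (auto simp: power_mult indicator_def)
  qed
  also have "\<dots> = c * cap_poly k (r\<^sup>2) b - c * cap_poly k (r\<^sup>2) a"
  proof (rule nn_integral_FTC_Icc)
    fix t assume "t \<in> {a..b}"
    then have t: "a \<le> t" "t \<le> b" by auto
    show "((\<lambda>t. c * cap_poly k (r\<^sup>2) t) has_real_derivative c * (r\<^sup>2 - t\<^sup>2) ^ k) (at t)"
      by (intro DERIV_cmult cap_poly_has_derivative)
    have "t\<^sup>2 \<le> r\<^sup>2" using t ab by (intro abs_le_square_iff[THEN iffD1]) auto
    then show "0 \<le> c * (r\<^sup>2 - t\<^sup>2) ^ k" using c by simp
  qed (use ab in auto)
  finally have *: "emeasure lborel {x. norm x \<le> r \<and> x \<bullet> e \<in> {a..b}} =
    ennreal (c * cap_poly k (r\<^sup>2) b - c * cap_poly k (r\<^sup>2) a)" .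
  \<comment> \<open>\<open>ennreal\<close> sends negative numbers to 0, so returning to real
    measures needs this sign; it holds because the integrand is nonnegative on the slab.\<close>
  have "c * cap_poly k (r\<^sup>2) a \<le> c * cap_poly k (r\<^sup>2) b"
  proof (intro mult_left_mono c DERIV_nonneg_imp_nondecreasing[OF ab(2)])
    fix t assume t: "a \<le> t" "t \<le> b"
    have "t\<^sup>2 \<le> r\<^sup>2" using t ab by (intro abs_le_square_iff[THEN iffD1]) auto
    then show "\<exists>y. (cap_poly k (r\<^sup>2) has_real_derivative y) (at t) \<and> 0 \<le> y"
      by (intro exI[of _ "(r\<^sup>2 - t\<^sup>2) ^ k"] conjI cap_poly_has_derivative) simp
  qed
  with * have "measure lborel {x. norm x \<le> r \<and> x \<bullet> e \<in> {a..b}} =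
      c * cap_poly k (r\<^sup>2) b - c * cap_poly k (r\<^sup>2) a"
    by (simp add: measure_def)
  with rotate show ?thesis by (simp add: c_def algebra_simps)
qed

lemma fmeasurable_subset_cball:
  fixes S :: "'a::euclidean_space set"
  assumes "S \<in> sets borel" "S \<subseteq> cball 0 r"
  shows "S \<in> fmeasurable lborel"
proof (rule fmeasurableI2)
  show "cball (0::'a) r \<in> fmeasurable lborel" by (rule fmeasurable_compact) simp
qed (use assms in auto)

text \<open>The slab formula stays strictly inside the ball, so it is not applied from the pole -r
  up to \<open>t\<close>. Instead, two opposite half-spaces that overlap in a slab cover the ball,
  and the reflection x -> -x expresses both through the same function \<open>D\<close>.\<close>

lemma measure_cball_halfspace:
  fixes u :: "real^'n"
  assumes n: "CARD('n) = 2 * k + 1" and u: "norm u = 1" and t: "\<bar>t\<bar> < r"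
  shows "measure lborel {x. norm x \<le> r \<and> x \<bullet> u \<le> t} =
    measure lborel (cball (0::real^'n) r) / 2 + unit_ball_vol (real (2 * k)) * cap_poly k (r\<^sup>2) t"
proof -
  define D where "D s = measure lborel {x. norm x \<le> r \<and> x \<bullet> u \<le> s}" for s
  define c where "c = unit_ball_vol (real (2 * k))"
  define B where "B = cball (0::real^'n) r"
  have fm: "S \<in> fmeasurable lborel" if "S \<in> sets borel" "\<And>x. x \<in> S \<Longrightarrow> norm x \<le> r" for S :: "(real^'n) set"
    using that by (intro fmeasurable_subset_cball[of _ r]) auto
  have reflect: "measure lborel {x. norm x \<le> r \<and> s \<le> x \<bullet> u} = D (- s)" for s
  proof -
    have o: "orthogonal_transformation (uminus :: real^'n \<Rightarrow> _)"
      by (simp add: orthogonal_transformation_neg)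
    have "uminus -` {x. norm x \<le> r \<and> s \<le> x \<bullet> u} = {x. norm x \<le> r \<and> x \<bullet> u \<le> - s}" by auto
    then show ?thesis
      using measure_lborel_orthogonal_vimage[OF o measurable_cball_slab(2)[of r s u]] by (simp add: D_def)
  qed
  have slab: "D b + D (- a) = measure lborel B + c * (cap_poly k (r\<^sup>2) b - cap_poly k (r\<^sup>2) a)"
    if ab: "- r < a" "a \<le> b" "b < r" for a b
  proof -
    have "measure lborel ({x. norm x \<le> r \<and> x \<bullet> u \<le> b} \<union> {x. norm x \<le> r \<and> a \<le> x \<bullet> u}) =
      measure lborel {x. norm x \<le> r \<and> x \<bullet> u \<le> b} + measure lborel {x. norm x \<le> r \<and> a \<le> x \<bullet> u} -
      measure lborel ({x. norm x \<le> r \<and> x \<bullet> u \<le> b} \<inter> {x. norm x \<le> r \<and> a \<le> x \<bullet> u})"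
      by (intro measure_Un3 fm) auto
    moreover have "{x. norm x \<le> r \<and> x \<bullet> u \<le> b} \<union> {x. norm x \<le> r \<and> a \<le> x \<bullet> u} = B"
      using ab by (auto simp: B_def)
    moreover have "{x. norm x \<le> r \<and> x \<bullet> u \<le> b} \<inter> {x. norm x \<le> r \<and> a \<le> x \<bullet> u} =
      {x. norm x \<le> r \<and> x \<bullet> u \<in> {a..b}}" by auto
    ultimately show ?thesis
      using measure_cball_slab[OF n u ab] by (simp add: reflect D_def c_def)
  qed
  \<comment> \<open>The symmetric slab from -s to s makes both terms on the left equal to
    \<open>D s\<close>, and oddness doubles the cap term.\<close>
  have pos: "D s = measure lborel B / 2 + c * cap_poly k (r\<^sup>2) s" if "0 \<le> s" "s < r" for s
    using slab[of "- s" s] that by (simp add: cap_poly_uminus)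
  have "D t = measure lborel B / 2 + c * cap_poly k (r\<^sup>2) t"
  proof (cases "0 \<le> t")
    case True
    then show ?thesis using pos t by simp
  next
    case False
    \<comment> \<open>The degenerate slab with a = b = t carries no volume, which reduces negative
      heights to positive ones.\<close>
    have "D t + D (- t) = measure lborel B" using slab[of t t] t by simp
    then show ?thesis using False pos[of "- t"] t by (simp add: cap_poly_uminus)
  qed
  then show ?thesis by (simp add: D_def B_def c_def)
qed

text \<open>The shell is the closed outer ball without the open inner one, and the inner sphere is a
  null set. The bound on \<open>t\<close> by the inner radius makes the half-space formula valid for
  both balls.\<close>

lemma measure_shell_halfspace:
  fixes u :: "real^'n"
  assumes n: "CARD('n) = 2 * k + 1" and u: "norm u = 1"
    and q: "0 \<le> q1" "q1 \<le> q2" and t: "\<bar>t\<bar> < sqrt q1"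
  shows "measure lborel {x::real^'n. (norm x)\<^sup>2 \<in> {q1..q2} \<and> x \<bullet> u \<le> t} =
    measure lborel {x::real^'n. (norm x)\<^sup>2 \<in> {q1..q2}} / 2 +
    unit_ball_vol (real (2 * k)) * (cap_poly k q2 t - cap_poly k q1 t)"
proof -
  define r1 r2 where "r1 = sqrt q1" and "r2 = sqrt q2"
  have r: "0 \<le> r1" "r1 \<le> r2" "r1\<^sup>2 = q1" "r2\<^sup>2 = q2" "\<bar>t\<bar> < r1" using q t by (auto simp: r1_def r2_def)
  have between: "(norm x)\<^sup>2 \<in> {q1..q2} \<longleftrightarrow> norm x \<le> r2 \<and> \<not> norm x < r1" for x :: "real^'n"
  proof -
    have "(norm x)\<^sup>2 \<le> q2 \<longleftrightarrow> norm x \<le> r2" "q1 \<le> (norm x)\<^sup>2 \<longleftrightarrow> r1 \<le> norm x"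
      unfolding r(3,4)[symmetric] using r(1,2) by (auto intro!: power_mono_iff)
    then show ?thesis by auto
  qed
  \<comment> \<open>Kept general in \<open>H\<close> to serve both the half-space and, with
    \<open>UNIV\<close>, the whole shell.\<close>
  have diff: "measure lborel ({x. (norm x)\<^sup>2 \<in> {q1..q2}} \<inter> H) =
      measure lborel (cball 0 r2 \<inter> H) - measure lborel (cball 0 r1 \<inter> H)"
    if H [measurable]: "H \<in> sets borel" for H :: "(real^'n) set"
  proof -
    have "{x. (norm x)\<^sup>2 \<in> {q1..q2}} \<inter> H = (cball 0 r2 \<inter> H) - (ball 0 r1 \<inter> H)"
      by (auto simp: between simp del: atLeastAtMost_iff)
    moreover have "measure lborel ((cball 0 r2 \<inter> H) - (ball 0 r1 \<inter> H)) =
        measure lborel (cball 0 r2 \<inter> H) - measure lborel (ball 0 r1 \<inter> H)"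
    proof (rule measurable_measure_Diff)
      show "cball 0 r2 \<inter> H \<in> fmeasurable lborel"
        by (rule fmeasurable_subset_cball[of _ r2]) auto
      show "ball 0 r1 \<inter> H \<subseteq> cball 0 r2 \<inter> H" using r(2) by auto
    qed simp
    moreover have "measure lborel (cball 0 r1 \<inter> H) = measure lborel ((ball 0 r1 \<inter> H) \<union> (sphere 0 r1 \<inter> H))"
      by (rule arg_cong[where f = "measure lborel"]) auto
    moreover have "measure lborel ((ball 0 r1 \<inter> H) \<union> (sphere 0 r1 \<inter> H)) = measure lborel (ball 0 r1 \<inter> H)"
    proof (rule measure_Un_null_set)
      have "sphere 0 r1 \<in> null_sets (lborel :: (real^'n) measure)"
        using negligible_sphere[of "0::real^'n" r1] by (simp add: negligible_iff_null_sets null_sets_completion_iff)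
      then show "sphere 0 r1 \<inter> H \<in> null_sets lborel" by (rule null_set_Int2) simp
    qed simp
    ultimately show ?thesis by simp
  qed
  have cball: "cball 0 r \<inter> {x. x \<bullet> u \<le> t} = {x. norm x \<le> r \<and> x \<bullet> u \<le> t}" for r
    by auto
  have "measure lborel {x::real^'n. (norm x)\<^sup>2 \<in> {q1..q2} \<and> x \<bullet> u \<le> t} =
      measure lborel (cball 0 r2 \<inter> {x. x \<bullet> u \<le> t}) - measure lborel (cball 0 r1 \<inter> {x. x \<bullet> u \<le> t})"
    using diff[of "{x. x \<bullet> u \<le> t}"] by (simp add: Collect_conj_eq Int_assoc)
  also have "\<dots> = measure lborel {x. norm x \<le> r2 \<and> x \<bullet> u \<le> t} - measure lborel {x. norm x \<le> r1 \<and> x \<bullet> u \<le> t}"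
    by (simp add: cball)
  also have "\<dots> = (measure lborel (cball (0::real^'n) r2) - measure lborel (cball (0::real^'n) r1)) / 2 +
     unit_ball_vol (real (2 * k)) * (cap_poly k q2 t - cap_poly k q1 t)"
    using r by (simp add: measure_cball_halfspace[OF n u] field_simps)
  also have "measure lborel (cball (0::real^'n) r2) - measure lborel (cball (0::real^'n) r1) =
     measure lborel {x::real^'n. (norm x)\<^sup>2 \<in> {q1..q2}}"
    using diff[of UNIV] by simp
  finally show ?thesis .
qed

section \<open>Integrating over the fibres\<close>

text \<open>Fubini with the second coordinate outermost, because the tube has simple slices at fixed
  y.\<close>

lemma measure_lborel_slices:
  fixes A :: "('a::euclidean_space \<times> 'b::euclidean_space) set"
  assumes A: "A \<in> fmeasurable lborel"
  shows integrable_measure_slice: "integrable lborel (\<lambda>y. measure lborel {x. (x, y) \<in> A})"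
    and measure_eq_integral_slice: "measure lborel A = (LINT y|lborel. measure lborel {x. (x, y) \<in> A})"
proof -
  have slice: "(LINT x|lborel. indicator A (x, y)) = measure lborel {x. (x, y) \<in> A}" for y
  proof -
    have "(LINT x|lborel. indicator A (x, y) :: real) = (LINT x|lborel. indicator {x. (x, y) \<in> A} x)"
      by (intro Bochner_Integration.integral_cong) (auto simp: indicator_def)
    then show ?thesis by simp
  qed
  have "integrable (lborel \<Otimes>\<^sub>M lborel) (indicator A :: _ \<Rightarrow> real)"
    using A by (auto simp: lborel_prod fmeasurable_def)
  then have int: "integrable (lborel \<Otimes>\<^sub>M lborel) (\<lambda>(x, y). indicator A (x, y) :: real)"
    by simp
  show "integrable lborel (\<lambda>y. measure lborel {x. (x, y) \<in> A})"
    using lborel_pair.integrable_snd[OF int] by (simp add: slice)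
  show "measure lborel A = (LINT y|lborel. measure lborel {x. (x, y) \<in> A})"
    using lborel_pair.integral_snd[OF int] by (simp add: slice lborel_prod)
qed

section \<open>Moments of radial weights against a linear form\<close>

lemma integral_radial_inner_power:
  fixes h :: "real \<Rightarrow> real" and \<gamma> e :: "real^'m"
  assumes h [measurable]: "h \<in> borel_measurable borel" and e: "norm e = 1"
  shows "(LINT y|lborel. h (norm y) * (y \<bullet> \<gamma>) ^ i) =
    norm \<gamma> ^ i * (LINT y|lborel. h (norm y) * (y \<bullet> e) ^ i)"
proof -
  \<comment> \<open>Rotating the multiple of \<open>e\<close> of length \<open>norm \<gamma>\<close>
    onto \<open>\<gamma>\<close> includes the case \<open>\<gamma> = 0\<close>, where normalising
    would fail.\<close>
  have "norm (norm \<gamma> *\<^sub>R e) = norm \<gamma>" using e by simp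
  then obtain f where f: "orthogonal_transformation f" and fe: "f (norm \<gamma> *\<^sub>R e) = \<gamma>"
    using orthogonal_transformation_exists by metis
  have "(LINT y|lborel. h (norm y) * (y \<bullet> \<gamma>) ^ i) = (LINT y|lborel. h (norm (f y)) * (f y \<bullet> \<gamma>) ^ i)"
    by (intro integral_lborel_orthogonal_transformation[OF f, symmetric]) measurable
  also have "\<dots> = (LINT y|lborel. norm \<gamma> ^ i * (h (norm y) * (y \<bullet> e) ^ i))"
  proof (intro Bochner_Integration.integral_cong refl)
    fix y
    have "f y \<bullet> \<gamma> = norm \<gamma> * (y \<bullet> e)"
      using f by (subst fe[symmetric]) (simp add: orthogonal_transformation_def)
    then show "h (norm (f y)) * (f y \<bullet> \<gamma>) ^ i = norm \<gamma> ^ i * (h (norm y) * (y \<bullet> e) ^ i)"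
      by (simp add: orthogonal_transformation_norm[OF f] power_mult_distrib)
  qed
  finally show ?thesis by simp
qed

text \<open>The substitution y -> -y preserves the weight and negates the odd power, so the integral
  equals its own negative.\<close>

lemma integral_radial_inner_odd_power:
  fixes h :: "real \<Rightarrow> real" and \<gamma> :: "'a::euclidean_space"
  assumes h [measurable]: "h \<in> borel_measurable borel" and i: "odd i"
  shows "(LINT y|lborel. h (norm y) * (y \<bullet> \<gamma>) ^ i) = 0"
proof -
  have o: "orthogonal_transformation (uminus :: 'a \<Rightarrow> _)"
    by (simp add: orthogonal_transformation_neg)
  have "(LINT y|lborel. h (norm (- y)) * (- y \<bullet> \<gamma>) ^ i) = (LINT y|lborel. h (norm y) * (y \<bullet> \<gamma>) ^ i)"
    by (intro integral_lborel_orthogonal_transformation[OF o]) measurable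
  then show ?thesis using i by (simp add: power_minus_odd)
qed

lemma sum_even_indices:
  fixes F :: "nat \<Rightarrow> 'a::comm_monoid_add"
  assumes "\<And>i. odd i \<Longrightarrow> F i = 0"
  shows "(\<Sum>i\<le>2 * l + 1. F i) = (\<Sum>i\<le>l. F (2 * i))"
  proof (induction l)
  case (Suc l)
  have "{..2 * Suc l + 1} = {..Suc (Suc (2 * l + 1))}" by simp
  then show ?case using Suc assms[of "Suc (Suc (2 * l + 1))"] by simp
qed (use assms[of 1] in simp)

text \<open>After binomial expansion only even powers of the linear form survive, so their signs are
  1. The remaining integrals involve the unit vector \<open>e\<close> alone and are therefore
  independent of \<open>\<gamma>\<close> and \<open>\<beta>\<close>.\<close>

lemma integral_radial_affine_odd_power:
  fixes h :: "real \<Rightarrow> real" and \<gamma> e :: "real^'m"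
  assumes h [measurable]: "h \<in> borel_measurable borel" and e: "norm e = 1"
    and int: "\<And>i. integrable lborel (\<lambda>y. h (norm y) * (y \<bullet> \<gamma>) ^ i)"
  shows "integrable lborel (\<lambda>y. h (norm y) * (\<beta> - y \<bullet> \<gamma>) ^ (2 * l + 1))"
    and "(LINT y|lborel. h (norm y) * (\<beta> - y \<bullet> \<gamma>) ^ (2 * l + 1)) =
      (\<Sum>i\<le>l. real ((2 * l + 1) choose (2 * i)) * (LINT y|lborel. h (norm y) * (y \<bullet> e) ^ (2 * i)) *
         norm \<gamma> ^ (2 * i) * \<beta> ^ (2 * (l - i) + 1))"
proof -
  let ?N = "2 * l + 1"
  define a where "a i = real (?N choose i) * (- 1) ^ i * \<beta> ^ (?N - i)" for i
  have expand: "h (norm y) * (\<beta> - y \<bullet> \<gamma>) ^ ?N = (\<Sum>i\<le>?N. a i * (h (norm y) * (y \<bullet> \<gamma>) ^ i))" for y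
  proof -
    have "(\<beta> - y \<bullet> \<gamma>) ^ ?N = (- (y \<bullet> \<gamma>) + \<beta>) ^ ?N" by simp
    also have "\<dots> = (\<Sum>i\<le>?N. a i * (y \<bullet> \<gamma>) ^ i)"
      unfolding binomial_ring a_def
      by (intro sum.cong refl) (simp add: power_minus[of "y \<bullet> \<gamma>"] mult_ac)
    finally show ?thesis by (simp only: sum_distrib_left mult.left_commute)
  qed
  show "integrable lborel (\<lambda>y. h (norm y) * (\<beta> - y \<bullet> \<gamma>) ^ ?N)"
    unfolding expand by (intro Bochner_Integration.integrable_sum integrable_mult_right int)
  have "(LINT y|lborel. h (norm y) * (\<beta> - y \<bullet> \<gamma>) ^ ?N) =
      (\<Sum>i\<le>?N. a i * (LINT y|lborel. h (norm y) * (y \<bullet> \<gamma>) ^ i))"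
    unfolding expand
    by (subst Bochner_Integration.integral_sum) (auto intro!: integrable_mult_right int)
  also have "\<dots> = (\<Sum>i\<le>l. a (2 * i) * (LINT y|lborel. h (norm y) * (y \<bullet> \<gamma>) ^ (2 * i)))"
    by (intro sum_even_indices) (simp add: integral_radial_inner_odd_power)
  also have "\<dots> = (\<Sum>i\<le>l. real (?N choose (2 * i)) * (LINT y|lborel. h (norm y) * (y \<bullet> e) ^ (2 * i)) *
         norm \<gamma> ^ (2 * i) * \<beta> ^ (2 * (l - i) + 1))"
  proof (intro sum.cong refl)
    fix i assume "i \<in> {..l}"
    then have "?N - 2 * i = 2 * (l - i) + 1" by auto
    then show "a (2 * i) * (LINT y|lborel. h (norm y) * (y \<bullet> \<gamma>) ^ (2 * i)) =
      real (?N choose (2 * i)) * (LINT y|lborel. h (norm y) * (y \<bullet> e) ^ (2 * i)) *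
         norm \<gamma> ^ (2 * i) * \<beta> ^ (2 * (l - i) + 1)"
      using integral_radial_inner_power[OF h e, of \<gamma> "2 * i"] by (simp only: a_def) simp
  qed
  finally show "(LINT y|lborel. h (norm y) * (\<beta> - y \<bullet> \<gamma>) ^ ?N) =
      (\<Sum>i\<le>l. real (?N choose (2 * i)) * (LINT y|lborel. h (norm y) * (y \<bullet> e) ^ (2 * i)) *
         norm \<gamma> ^ (2 * i) * \<beta> ^ (2 * (l - i) + 1))" .
qed

text \<open>The coefficient of t^(2l+1) in the cap difference for the squared radii 1 + s and 1 - s
  of a slice. As a function of s it becomes a radial weight in y.\<close>

definition cap_diff_coeff :: "nat \<Rightarrow> nat \<Rightarrow> real \<Rightarrow> real" where
  "cap_diff_coeff k l s =
     real (k choose l) * (- 1) ^ l / real (2 * l + 1) * ((1 + s) ^ (k - l) - (1 - s) ^ (k - l))"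

lemma cap_poly_diff:
  "cap_poly k (1 + s) t - cap_poly k (1 - s) t = (\<Sum>l<k. cap_diff_coeff k l s * t ^ (2 * l + 1))"
proof -
  have "cap_poly k (1 + s) t - cap_poly k (1 - s) t = (\<Sum>l\<le>k. cap_diff_coeff k l s * t ^ (2 * l + 1))"
    unfolding cap_poly_def sum_subtractf[symmetric]
  proof (intro sum.cong refl)
    fix l
    have "x * y * p * T / d - x * y * q * T / d = x * y / d * (p - q) * T" for x y p q T d :: real
      by (simp add: field_simps diff_divide_distrib)
    then show "real (k choose l) * (- 1) ^ l * (1 + s) ^ (k - l) * t ^ (2 * l + 1) / real (2 * l + 1) -
      real (k choose l) * (- 1) ^ l * (1 - s) ^ (k - l) * t ^ (2 * l + 1) / real (2 * l + 1) =
      cap_diff_coeff k l s * t ^ (2 * l + 1)"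
      unfolding cap_diff_coeff_def by blast
  qed
  \<comment> \<open>At \<open>l = k\<close> both powers have exponent 0, so this coefficient is zero
    and the sum stops at \<open>k - 1\<close>.\<close>
  also have "\<dots> = (\<Sum>l<k. cap_diff_coeff k l s * t ^ (2 * l + 1))"
    by (simp add: lessThan_Suc_atMost[symmetric] cap_diff_coeff_def[of k k])
  finally show ?thesis .
qed

section \<open>Half-spaces cutting the tube\<close>

definition tube :: "real \<Rightarrow> ('a::euclidean_space \<times> 'b::euclidean_space) set" where
  "tube \<epsilon> = {(x, y). ((norm x)\<^sup>2 - 1)\<^sup>2 + (norm y)\<^sup>2 \<le> \<epsilon>\<^sup>2}"

lemma tube_slice:
  assumes "0 < \<epsilon>"
  shows "(x, y) \<in> tube \<epsilon> \<longleftrightarrow>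
    norm y \<le> \<epsilon> \<and> (norm x)\<^sup>2 \<in> {1 - sqrt (\<epsilon>\<^sup>2 - (norm y)\<^sup>2)..1 + sqrt (\<epsilon>\<^sup>2 - (norm y)\<^sup>2)}"
proof -
  define s where "s = sqrt (\<epsilon>\<^sup>2 - (norm y)\<^sup>2)"
  have "(x, y) \<in> tube \<epsilon> \<longleftrightarrow> norm y \<le> \<epsilon> \<and> ((norm x)\<^sup>2 - 1)\<^sup>2 \<le> \<epsilon>\<^sup>2 - (norm y)\<^sup>2"
  proof -
    have "norm y \<le> \<epsilon>" if "((norm x)\<^sup>2 - 1)\<^sup>2 + (norm y)\<^sup>2 \<le> \<epsilon>\<^sup>2"
    proof -
      have "(norm y)\<^sup>2 \<le> \<epsilon>\<^sup>2" using that zero_le_power2[of "(norm x)\<^sup>2 - 1"] by linarith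
      then show ?thesis by (rule power2_le_imp_le) (use assms in simp)
    qed
    then show ?thesis by (auto simp: tube_def)
  qed
  also have "\<dots> \<longleftrightarrow> norm y \<le> \<epsilon> \<and> (norm x)\<^sup>2 \<in> {1 - s..1 + s}"
  \<comment> \<open>Under the guard \<open>norm y \<le> \<epsilon>\<close> the radicand is
    nonnegative, so squaring undoes the square root.\<close>
  proof (rule conj_cong[OF refl])
    assume "norm y \<le> \<epsilon>"
    then have "(norm y)\<^sup>2 \<le> \<epsilon>\<^sup>2" by (simp add: power_mono)
    then have s: "0 \<le> s" "s\<^sup>2 = \<epsilon>\<^sup>2 - (norm y)\<^sup>2" by (simp_all add: s_def)
    have "((norm x)\<^sup>2 - 1)\<^sup>2 \<le> s\<^sup>2 \<longleftrightarrow> \<bar>(norm x)\<^sup>2 - 1\<bar> \<le> s"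
      using s(1) abs_le_square_iff[of "(norm x)\<^sup>2 - 1" s] by simp
    then show "((norm x)\<^sup>2 - 1)\<^sup>2 \<le> \<epsilon>\<^sup>2 - (norm y)\<^sup>2 \<longleftrightarrow> (norm x)\<^sup>2 \<in> {1 - s..1 + s}"
      unfolding s(2) by auto
  qed
  finally show ?thesis by (simp only: s_def)
qed

lemma closed_tube: "closed (tube \<epsilon>)"
  unfolding tube_def case_prod_unfold by (intro closed_Collect_le continuous_intros)

lemma fmeasurable_tube:
  assumes "0 < \<epsilon>" "\<epsilon> < 1"
  shows "(tube \<epsilon> :: ('a::euclidean_space \<times> 'b::euclidean_space) set) \<in> fmeasurable lborel"
\<comment> \<open>The radius 2 suffices: |x|^2 <= 1 + s <= 2 and |y|^2 <= 1.\<close>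
proof (rule fmeasurable_subset_cball[of _ 2])
  show "(tube \<epsilon> :: ('a \<times> 'b) set) \<subseteq> cball 0 2"
  proof clarify
    fix x :: 'a and y :: 'b assume xy: "(x, y) \<in> tube \<epsilon>"
    have e2: "\<epsilon>\<^sup>2 \<le> 1" using assms by (simp add: power_le_one)
    then have "\<epsilon>\<^sup>2 - (norm y)\<^sup>2 \<le> 1" using zero_le_power2[of "norm y"] by linarith
    then have "sqrt (\<epsilon>\<^sup>2 - (norm y)\<^sup>2) \<le> 1" unfolding real_sqrt_le_1_iff .
    then have "(norm x)\<^sup>2 \<le> 2" "norm y \<le> 1"
      using xy assms(2) unfolding tube_slice[OF assms(1)] atLeastAtMost_iff by linarith+
    moreover from this(2) have "(norm y)\<^sup>2 \<le> 1" by (simp add: power_le_one)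
    ultimately have "(norm x)\<^sup>2 + (norm y)\<^sup>2 \<le> 2\<^sup>2" by simp
    then show "(x, y) \<in> cball 0 2" by (simp add: norm_Pair real_le_lsqrt)
  qed
qed (simp add: closed_tube borel_closed)

text \<open>The coefficients \<open>M\<close> are chosen before the hyperplane, so one polynomial
  serves the whole neighborhood. \<open>M (k - 1) 0\<close> belongs to the monomial b^(2k-1); its
  being nonzero fixes the degree.\<close>

lemma measure_tube_halfspace:
  fixes \<epsilon> :: real
  assumes k: "k \<ge> 1" and n: "CARD('n) = 2 * k + 1" and \<epsilon>: "0 < \<epsilon>" "\<epsilon> < 1"
  obtains M :: "nat \<Rightarrow> nat \<Rightarrow> real" where "M (k - 1) 0 \<noteq> 0"
    and "\<And>(\<alpha>::real^'n) (\<gamma>::real^'m) \<beta>. norm \<alpha> = 1 \<Longrightarrow> norm \<gamma> * \<epsilon> + \<bar>\<beta>\<bar> < sqrt (1 - \<epsilon>) \<Longrightarrow>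
      measure lborel (tube \<epsilon> \<inter> {z. (\<alpha>, \<gamma>) \<bullet> z \<le> \<beta>}) = measure lborel (tube \<epsilon> :: ((real^'n) \<times> (real^'m)) set) / 2 +
        (\<Sum>l<k. \<Sum>i\<le>l. M l i * norm \<gamma> ^ (2 * i) * \<beta> ^ (2 * (l - i) + 1))"
proof -
  let ?W = "tube \<epsilon> :: ((real^'n) \<times> (real^'m)) set"
  define c where "c = unit_ball_vol (real (2 * k))"
  define s where "s = (\<lambda>\<rho>::real. sqrt (\<epsilon>\<^sup>2 - \<rho>\<^sup>2))"
  \<comment> \<open>The indicator confines the weight to the y that meet the tube; beyond them
    \<open>s\<close> would take roots of negative numbers.\<close>
  define h where "h = (\<lambda>l \<rho>. indicator {..\<epsilon>} \<rho> * cap_diff_coeff k l (s \<rho>))"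
  define e :: "real^'m" where "e = axis undefined 1"
  have e: "norm e = 1" by (simp add: e_def norm_axis_1)
  define J where "J l i = (LINT y|lborel. h l (norm y) * (y \<bullet> e) ^ (2 * i))" for l i
  define M where "M l i = c * (real ((2 * l + 1) choose (2 * i)) * J l i)" for l i
  have cont: "continuous_on S (\<lambda>y. cap_diff_coeff k l (s (norm y)))" for l and S :: "(real^'m) set"
    unfolding cap_diff_coeff_def s_def by (intro continuous_intros)
  have h [measurable]: "h l \<in> borel_measurable borel" for l
    unfolding h_def cap_diff_coeff_def s_def by measurable
  have h_int: "integrable lborel (\<lambda>y. h l (norm y) * (y \<bullet> \<gamma>) ^ i)" for l i and \<gamma> :: "real^'m"
  proof -
    have "integrable lborel (\<lambda>y. indicator (cball 0 \<epsilon>) y *\<^sub>R (cap_diff_coeff k l (s (norm y)) * (y \<bullet> \<gamma>) ^ i))"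
      by (intro borel_integrable_compact continuous_intros cont) auto
    then show ?thesis by (simp add: h_def indicator_def mult_ac cong: if_cong)
  qed
  have "M (k - 1) 0 \<noteq> 0"
  proof -
    \<comment> \<open>At \<open>l = k - 1\<close> the bracket in \<open>cap_diff_coeff\<close> is (1
      + s) - (1 - s) = 2s, so the coefficient is linear in s with the factor
      \<open>d\<close>.\<close>
    define d where "d = real k * (- 1) ^ (k - 1) / real (2 * (k - 1) + 1) * 2"
    have d: "d \<noteq> 0" using k by (simp add: d_def)
    have cd: "cap_diff_coeff k (k - 1) \<sigma> = d * \<sigma>" for \<sigma>
    proof -
      have "k choose (k - 1) = k" using k binomial_symmetric[of 1 k] by simp
      moreover have "k - (k - 1) = 1" using k by simp
      ultimately show ?thesis by (simp add: cap_diff_coeff_def d_def)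
    qed
    define g where "g = (\<lambda>y::real^'m. indicator (cball 0 \<epsilon>) y *\<^sub>R s (norm y))"
    have g_int: "integrable lborel g"
      unfolding g_def s_def by (intro borel_integrable_compact continuous_intros) auto
    \<comment> \<open>On the ball of radius eps/2 one has s^2 >= 3 eps^2 / 4, hence s >= eps/2; this
      bounds the integral of s away from 0.\<close>
    have "0 < \<epsilon> / 2 * measure lborel (cball (0::real^'m) (\<epsilon> / 2))"
      using \<epsilon> content_cball_pos[of "\<epsilon> / 2" "0::real^'m"] by simp
    also have "\<dots> = (LINT y|lborel. \<epsilon> / 2 * indicator (cball (0::real^'m) (\<epsilon> / 2)) y)"
      by simp
    also have "\<dots> \<le> (LINT y|lborel. g y)"
    proof (intro integral_mono g_int)
      show "integrable lborel (\<lambda>y. \<epsilon> / 2 * indicator (cball (0::real^'m) (\<epsilon> / 2)) y)"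
        using fmeasurable_subset_cball[of "cball (0::real^'m) (\<epsilon> / 2)" "\<epsilon> / 2"]
        by (auto simp: fmeasurable_def)
      fix y :: "real^'m"
      show "\<epsilon> / 2 * indicator (cball 0 (\<epsilon> / 2)) y \<le> g y"
      proof (cases "norm y \<le> \<epsilon> / 2")
        case True
        then have "(norm y)\<^sup>2 \<le> (\<epsilon> / 2)\<^sup>2" by (simp add: power_mono)
        moreover have "(\<epsilon> / 2)\<^sup>2 = \<epsilon>\<^sup>2 / 4" by (simp add: power_divide)
        ultimately have "(\<epsilon> / 2)\<^sup>2 \<le> \<epsilon>\<^sup>2 - (norm y)\<^sup>2"
          using zero_le_power2[of \<epsilon>] by linarith
        then have "\<epsilon> / 2 \<le> s (norm y)" unfolding s_def by (rule real_le_rsqrt)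
        then show ?thesis using True \<epsilon> by (simp add: g_def)
      next
        case False
        have "0 \<le> s (norm y)" if "norm y \<le> \<epsilon>" using that by (simp add: s_def power_mono)
        then show ?thesis using False by (simp add: g_def indicator_def)
      qed
    qed
    finally have "(LINT y|lborel. g y) > 0" .
    moreover have "J (k - 1) 0 = (LINT y|lborel. d * g y)"
      unfolding J_def by (intro Bochner_Integration.integral_cong) (auto simp: h_def g_def cd[unfolded One_nat_def] indicator_def)
    moreover have "c > 0" by (simp add: c_def)
    ultimately show ?thesis using d by (simp add: M_def)
  qed
  moreover
  {
    fix \<alpha> :: "real^'n" and \<gamma> :: "real^'m" and \<beta> :: real
    assume \<alpha>: "norm \<alpha> = 1" and small: "norm \<gamma> * \<epsilon> + \<bar>\<beta>\<bar> < sqrt (1 - \<epsilon>)"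
    let ?H = "{z. (\<alpha>, \<gamma>) \<bullet> z \<le> \<beta>}"
    have WH: "?W \<inter> ?H \<in> fmeasurable lborel"
      using fmeasurable_tube[OF \<epsilon>] by (intro fmeasurable_Int_fmeasurable) auto
    have slices: "measure lborel {x. (x, y) \<in> ?W \<inter> ?H} = measure lborel {x. (x, y) \<in> ?W} / 2 +
        (\<Sum>l<k. c * (h l (norm y) * (\<beta> - y \<bullet> \<gamma>) ^ (2 * l + 1)))" for y
    proof (cases "norm y \<le> \<epsilon>")
      \<comment> \<open>Above such y the slice is empty and all weights vanish.\<close>
      case False
      then show ?thesis using \<epsilon> by (simp add: tube_slice h_def)
    next
      case True
      define \<sigma> where "\<sigma> = s (norm y)"
      have \<sigma>: "0 \<le> \<sigma>" "\<sigma> \<le> \<epsilon>"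
        using True \<epsilon> by (auto simp: \<sigma>_def s_def power_mono intro!: real_le_lsqrt)
      have t: "\<bar>\<beta> - y \<bullet> \<gamma>\<bar> < sqrt (1 - \<sigma>)"
      proof -
        have "\<bar>y \<bullet> \<gamma>\<bar> \<le> norm y * norm \<gamma>" by (rule Cauchy_Schwarz_ineq2)
        also have "\<dots> \<le> norm \<gamma> * \<epsilon>" using mult_right_mono[OF True norm_ge_zero[of \<gamma>]] by (simp only: mult.commute)
        finally have "\<bar>\<beta> - y \<bullet> \<gamma>\<bar> < sqrt (1 - \<epsilon>)" using small by linarith
        also have "\<dots> \<le> sqrt (1 - \<sigma>)" using \<sigma> by simp
        finally show ?thesis .
      qed
      have "{x. (x, y) \<in> ?W \<inter> ?H} = {x. (norm x)\<^sup>2 \<in> {1 - \<sigma>..1 + \<sigma>} \<and> x \<bullet> \<alpha> \<le> \<beta> - y \<bullet> \<gamma>}"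
        using True \<epsilon> by (auto simp: tube_slice \<sigma>_def s_def inner_commute)
      moreover have "{x. (x, y) \<in> ?W} = {x. (norm x)\<^sup>2 \<in> {1 - \<sigma>..1 + \<sigma>}}"
        using True \<epsilon> by (auto simp: tube_slice \<sigma>_def s_def)
      moreover have "measure lborel {x::real^'n. (norm x)\<^sup>2 \<in> {1 - \<sigma>..1 + \<sigma>} \<and> x \<bullet> \<alpha> \<le> \<beta> - y \<bullet> \<gamma>} =
          measure lborel {x::real^'n. (norm x)\<^sup>2 \<in> {1 - \<sigma>..1 + \<sigma>}} / 2 +
          c * (cap_poly k (1 + \<sigma>) (\<beta> - y \<bullet> \<gamma>) - cap_poly k (1 - \<sigma>) (\<beta> - y \<bullet> \<gamma>))"
        unfolding c_def using \<sigma> \<epsilon> by (intro measure_shell_halfspace n \<alpha> t) auto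
      moreover have "h l (norm y) = cap_diff_coeff k l \<sigma>" for l
        using True by (simp add: h_def \<sigma>_def)
      ultimately show ?thesis by (simp add: cap_poly_diff sum_distrib_left)
    qed
    note radial = integral_radial_affine_odd_power[OF h e h_int]
    have "measure lborel (?W \<inter> ?H) = (LINT y|lborel. measure lborel {x. (x, y) \<in> ?W} / 2 +
        (\<Sum>l<k. c * (h l (norm y) * (\<beta> - y \<bullet> \<gamma>) ^ (2 * l + 1))))"
      unfolding measure_eq_integral_slice[OF WH] slices ..
    also have "\<dots> = (LINT y|lborel. measure lborel {x. (x, y) \<in> ?W} / 2) +
        (LINT y|lborel. (\<Sum>l<k. c * (h l (norm y) * (\<beta> - y \<bullet> \<gamma>) ^ (2 * l + 1))))"
      by (intro Bochner_Integration.integral_add integrable_divide Bochner_Integration.integrable_sum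
          integrable_mult_right radial(1) integrable_measure_slice fmeasurable_tube \<epsilon>)
    also have "(LINT y|lborel. measure lborel {x. (x, y) \<in> ?W} / 2) = measure lborel ?W / 2"
      using measure_eq_integral_slice[OF fmeasurable_tube[OF \<epsilon>], where 'a = "real^'n" and 'b = "real^'m"] by simp
    also have "(LINT y|lborel. (\<Sum>l<k. c * (h l (norm y) * (\<beta> - y \<bullet> \<gamma>) ^ (2 * l + 1)))) =
        (\<Sum>l<k. c * (LINT y|lborel. h l (norm y) * (\<beta> - y \<bullet> \<gamma>) ^ (2 * l + 1)))"
      by (subst Bochner_Integration.integral_sum, intro integrable_mult_right radial(1))
        (simp only: integral_mult_right_zero)
    also have "\<dots> = (\<Sum>l<k. \<Sum>i\<le>l. M l i * norm \<gamma> ^ (2 * i) * \<beta> ^ (2 * (l - i) + 1))"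
      unfolding radial(2) M_def J_def sum_distrib_left by (simp only: mult.assoc)
    finally have "measure lborel (?W \<inter> ?H) = measure lborel ?W / 2 +
      (\<Sum>l<k. \<Sum>i\<le>l. M l i * norm \<gamma> ^ (2 * i) * \<beta> ^ (2 * (l - i) + 1))" .
  }
  ultimately show thesis by (rule that)
qed

section \<open>Evaluation of polynomials\<close>

text \<open>Sums can cancel and lose keys; summing over a common finite superset makes evaluation
  visibly additive.\<close>

lemma mpoly_eval_superset:
  assumes "finite A" "Poly_Mapping.keys p \<subseteq> A"
  shows "mpoly_eval f p = (\<Sum>e\<in>A. Poly_Mapping.lookup p e *
    (\<Prod>v\<in>Poly_Mapping.keys e. f v ^ Poly_Mapping.lookup e v))"
  unfolding mpoly_eval_def using assms
  by (intro sum.mono_neutral_left) (auto simp: in_keys_iff)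

lemma mpoly_eval_zero [simp]: "mpoly_eval f 0 = 0"
  by (simp add: mpoly_eval_def)

lemma mpoly_eval_add: "mpoly_eval f (p + q) = mpoly_eval f p + mpoly_eval f q"
proof -
  let ?A = "Poly_Mapping.keys p \<union> Poly_Mapping.keys q"
  have "Poly_Mapping.keys (p + q) \<subseteq> ?A" by (rule Poly_Mapping.keys_add)
  then show ?thesis
    by (simp add: mpoly_eval_superset[of ?A] lookup_add distrib_right sum.distrib)
qed

lemma mpoly_eval_sum: "mpoly_eval f (\<Sum>i\<in>I. p i) = (\<Sum>i\<in>I. mpoly_eval f (p i))"
  by (induction I rule: infinite_finite_induct) (auto simp: mpoly_eval_add)

lemma mpoly_eval_single:
  "mpoly_eval f (Poly_Mapping.single e c) = c * (\<Prod>v\<in>Poly_Mapping.keys e. f v ^ Poly_Mapping.lookup e v)"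
  by (simp add: mpoly_eval_superset[of "{e}"])

lemma prod_keys_superset:
  fixes f :: "'v \<Rightarrow> real"
  assumes "finite A" "Poly_Mapping.keys e \<subseteq> A"
  shows "(\<Prod>v\<in>Poly_Mapping.keys e. f v ^ Poly_Mapping.lookup e v) = (\<Prod>v\<in>A. f v ^ Poly_Mapping.lookup e v)"
  using assms by (intro prod.mono_neutral_left) (auto simp: in_keys_iff)

lemma mpoly_eval_single_mult_single:
  "mpoly_eval f (Poly_Mapping.single d a * Poly_Mapping.single e b) =
    mpoly_eval f (Poly_Mapping.single d a) * mpoly_eval f (Poly_Mapping.single e b)"
proof -
  let ?A = "Poly_Mapping.keys d \<union> Poly_Mapping.keys e"
  have "(\<Prod>v\<in>Poly_Mapping.keys (d + e). f v ^ Poly_Mapping.lookup (d + e) v) =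
      (\<Prod>v\<in>?A. f v ^ Poly_Mapping.lookup (d + e) v)"
    by (rule prod_keys_superset) (auto simp: Poly_Mapping.keys_add)
  also have "\<dots> = (\<Prod>v\<in>Poly_Mapping.keys d. f v ^ Poly_Mapping.lookup d v) *
      (\<Prod>v\<in>Poly_Mapping.keys e. f v ^ Poly_Mapping.lookup e v)"
    by (simp add: prod_keys_superset[of ?A] lookup_add power_add prod.distrib)
  finally show ?thesis by (simp add: mult_single mpoly_eval_single)
qed

lemma poly_mapping_sum_single:
  "p = (\<Sum>e\<in>Poly_Mapping.keys p. Poly_Mapping.single e (Poly_Mapping.lookup p e))"
  by (rule poly_mapping_eqI) (simp add: lookup_sum lookup_single when_def in_keys_iff)

lemma mpoly_eval_mult: "mpoly_eval f (p * q) = mpoly_eval f p * mpoly_eval f q"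
proof -
  \<comment> \<open>Stated for arbitrary coefficient families because the expansion of
    \<open>p\<close> into monomials mentions \<open>p\<close> again, so rewriting with it directly
    would loop.\<close>
  have "mpoly_eval f ((\<Sum>d\<in>D. Poly_Mapping.single d (a d)) * (\<Sum>e\<in>E. Poly_Mapping.single e (b e))) =
      mpoly_eval f (\<Sum>d\<in>D. Poly_Mapping.single d (a d)) * mpoly_eval f (\<Sum>e\<in>E. Poly_Mapping.single e (b e))"
    for D E :: "('a \<Rightarrow>\<^sub>0 nat) set" and a b
    by (simp add: sum_product mpoly_eval_sum mpoly_eval_single_mult_single)
  then show ?thesis
    using poly_mapping_sum_single[of p] poly_mapping_sum_single[of q] by metis
qed

lemma mpoly_eval_power: "mpoly_eval f (p ^ n) = mpoly_eval f p ^ n"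
proof (induction n)
  case 0
  then show ?case using mpoly_eval_single[of f 0 1] by simp
qed (simp add: mpoly_eval_mult)

lemma mpoly_eval_diff: "mpoly_eval f (p - q) = mpoly_eval f p - mpoly_eval f q"
  using mpoly_eval_add[of f "p - q" q] by simp

definition mpoly_const :: "real \<Rightarrow> 'v mpolynomial" where
  "mpoly_const c = Poly_Mapping.single 0 c"

definition mpoly_var :: "'v \<Rightarrow> 'v mpolynomial" where
  "mpoly_var v = Poly_Mapping.single (Poly_Mapping.single v 1) 1"

lemma mpoly_eval_const [simp]: "mpoly_eval f (mpoly_const c) = c"
  by (simp add: mpoly_const_def mpoly_eval_single)

lemma mpoly_eval_var [simp]: "mpoly_eval f (mpoly_var v) = f v"
  by (simp add: mpoly_var_def mpoly_eval_single)

lemmas mpoly_eval_ring =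
  mpoly_eval_add mpoly_eval_diff mpoly_eval_mult mpoly_eval_power mpoly_eval_sum

section \<open>The polynomial in a and b\<close>

definition ab_mono :: "nat \<Rightarrow> nat \<Rightarrow> (ab_var \<Rightarrow>\<^sub>0 nat)" where
  "ab_mono i j = Poly_Mapping.single VarA i + Poly_Mapping.single VarB j"

lemma lookup_ab_mono [simp]:
  "Poly_Mapping.lookup (ab_mono i j) VarA = i" "Poly_Mapping.lookup (ab_mono i j) VarB = j"
  by (simp_all add: ab_mono_def lookup_add lookup_single)

lemma keys_ab_subset: "Poly_Mapping.keys (e :: ab_var \<Rightarrow>\<^sub>0 nat) \<subseteq> {VarA, VarB}"
  by (metis (full_types) ab_var.exhaust insertCI subsetI)

lemma ab_mono_eq_iff [simp]: "ab_mono i j = ab_mono i' j' \<longleftrightarrow> i = i' \<and> j = j'"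
  by (metis lookup_ab_mono)

lemma mono_degree_ab_mono [simp]: "mono_degree (ab_mono i j) = i + j"
proof -
  have "mono_degree (ab_mono i j) = (\<Sum>v\<in>{VarA, VarB}. Poly_Mapping.lookup (ab_mono i j) v)"
    unfolding mono_degree_def using keys_ab_subset[of "ab_mono i j"]
    by (intro sum.mono_neutral_left) (auto simp: in_keys_iff)
  then show ?thesis by simp
qed

lemma mpoly_eval_single_ab_mono:
  "mpoly_eval (case_ab_var a b) (Poly_Mapping.single (ab_mono i j) c) = c * a ^ i * b ^ j"
  by (simp add: mpoly_eval_single prod_keys_superset[OF _ keys_ab_subset])

text \<open>The part with index \<open>l\<close> is homogeneous of degree \<open>2 * l + 1\<close>;
  it stems from the power \<open>2 * l + 1\<close> of beta - gamma . y.\<close>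

definition vol_poly :: "nat \<Rightarrow> (nat \<Rightarrow> nat \<Rightarrow> real) \<Rightarrow> ab_var mpolynomial" where
  "vol_poly k M = (\<Sum>l<k. \<Sum>i\<le>l. Poly_Mapping.single (ab_mono (2 * i) (2 * (l - i) + 1)) (M l i))"

lemma mpoly_eval_vol_poly:
  "mpoly_eval (case_ab_var a b) (vol_poly k M) =
    (\<Sum>l<k. \<Sum>i\<le>l. M l i * a ^ (2 * i) * b ^ (2 * (l - i) + 1))"
  unfolding vol_poly_def mpoly_eval_sum mpoly_eval_single_ab_mono ..

lemma keys_vol_poly:
  assumes "e \<in> Poly_Mapping.keys (vol_poly k M)"
  obtains l i where "l < k" "i \<le> l" "e = ab_mono (2 * i) (2 * (l - i) + 1)"
proof -
  let ?g = "\<lambda>l i. Poly_Mapping.lookup (Poly_Mapping.single (ab_mono (2 * i) (2 * (l - i) + 1)) (M l i)) e"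
  have "(\<Sum>l<k. \<Sum>i\<le>l. ?g l i) \<noteq> 0"
    using assms by (simp only: in_keys_iff vol_poly_def lookup_sum) simp
  then obtain l where l: "l \<in> {..<k}" "(\<Sum>i\<le>l. ?g l i) \<noteq> 0"
    by (rule sum.not_neutral_contains_not_neutral)
  from l(2) obtain i where i: "i \<in> {..l}" "?g l i \<noteq> 0"
    by (rule sum.not_neutral_contains_not_neutral)
  from i(2) have "e = ab_mono (2 * i) (2 * (l - i) + 1)"
    by (simp add: lookup_single when_def split: if_splits)
  with l i show thesis using that by simp
qed

text \<open>The monomial b^(2k-1) arises only from \<open>l = k - 1\<close> and
  \<open>i = 0\<close>, so nothing can cancel its coefficient, and every other monomial has degree
  \<open>2 * l + 1\<close> for some \<open>l < k\<close>.\<close>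

lemma total_degree_vol_poly:
  assumes k: "k \<ge> 1" and M: "M (k - 1) 0 \<noteq> 0"
  shows "total_degree (vol_poly k M) = 2 * k - 1"
proof -
  let ?top = "ab_mono 0 (2 * k - 1)"
  have "Poly_Mapping.lookup (vol_poly k M) ?top = (\<Sum>l<k. \<Sum>i\<le>l. if i = 0 \<and> l = k - 1 then M l i else 0)"
    unfolding vol_poly_def lookup_sum using k
    by (intro sum.cong refl) (auto simp: lookup_single when_def)
  also have "\<dots> = (\<Sum>l<k. if l = k - 1 then M l 0 else 0)"
    by (intro sum.cong refl) (simp add: if_if_eq_conj[symmetric] sum.delta)
  also have "\<dots> = M (k - 1) 0" using k by simp
  finally have "?top \<in> Poly_Mapping.keys (vol_poly k M)" using M by (simp add: in_keys_iff)
  moreover have "mono_degree e \<le> 2 * k - 1" if "e \<in> Poly_Mapping.keys (vol_poly k M)" for e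
    using that
  proof (rule keys_vol_poly)
    fix l i assume li: "l < k" "i \<le> l" and e: "e = ab_mono (2 * i) (2 * (l - i) + 1)"
    show "mono_degree e \<le> 2 * k - 1" using li unfolding e mono_degree_ab_mono by arith
  qed
  moreover have "mono_degree ?top = 2 * k - 1" by simp
  ultimately show ?thesis
    unfolding total_degree_def by (intro Max_eqI) (auto intro: rev_image_eqI)
qed

text \<open>This oddness in b turns a reversed orientation of the hyperplane, or the passage from
  beta to |beta|, into an exchange of the two volumes.\<close>

lemma sum_odd_powers_minus:
  "(\<Sum>l<k. \<Sum>i\<le>l. M l i * (a::real) ^ (2 * i) * (- b) ^ (2 * (l - i) + 1)) =
    - (\<Sum>l<k. \<Sum>i\<le>l. M l i * a ^ (2 * i) * b ^ (2 * (l - i) + 1))"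
  by (simp add: sum_negf[symmetric] del: power_Suc)

text \<open>The witness clears denominators in \<open>(V - C)\<^sup>2 = p\<^sup>2\<close>: after multiplication by \<open>norm \<alpha> ^ (2 * k - 1)\<close>,
  only even powers of the two norms remain in \<open>p\<close>.\<close>

lemma volume_algebraic_onI:
  fixes W :: "((real^'n) \<times> (real^'m)) set"
  assumes k: "k \<ge> 1"
    and vol: "\<And>\<alpha> \<gamma> \<beta>. (\<alpha>, \<gamma>) \<noteq> 0 \<Longrightarrow> hyperplane (\<alpha>, \<gamma>) \<beta> \<in> U \<Longrightarrow>
      \<alpha> \<noteq> 0 \<and> (\<forall>v\<in>volume_values W (hyperplane (\<alpha>, \<gamma>) \<beta>).
        (v - C)\<^sup>2 = (\<Sum>l<k. \<Sum>i\<le>l. M l i * (norm \<gamma> / norm \<alpha>) ^ (2 * i) * (\<beta> / norm \<alpha>) ^ (2 * (l - i) + 1))\<^sup>2)"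
  shows "volume_algebraic_on W U"
proof -
  define A :: "('n, 'm) hyp_var mpolynomial" where "A = (\<Sum>i\<in>UNIV. mpoly_var (VarAlpha i) ^ 2)"
  define G :: "('n, 'm) hyp_var mpolynomial" where "G = (\<Sum>j\<in>UNIV. mpoly_var (VarGamma j) ^ 2)"
  define R :: "('n, 'm) hyp_var mpolynomial" where
    "R = (\<Sum>l<k. \<Sum>i\<le>l. mpoly_const (M l i) * G ^ i * mpoly_var VarBeta ^ (2 * (l - i) + 1) * A ^ (k - 1 - l))"
  define Q where "Q = A ^ (2 * k - 1) * (mpoly_var VarV - mpoly_const C) ^ 2 - R ^ 2"
  have norm2: "(norm x)\<^sup>2 = (\<Sum>i\<in>UNIV. (x $ i)\<^sup>2)" for x :: "real^'z"
    by (simp add: norm_vec_def L2_set_def sum_nonneg)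
  have eval: "mpoly_eval (case_hyp_var v (\<lambda>i. \<alpha> $ i) (\<lambda>j. \<gamma> $ j) \<beta>) Q =
      ((norm \<alpha>)\<^sup>2) ^ (2 * k - 1) * (v - C)\<^sup>2 -
      (\<Sum>l<k. \<Sum>i\<le>l. M l i * ((norm \<gamma>)\<^sup>2) ^ i * \<beta> ^ (2 * (l - i) + 1) * ((norm \<alpha>)\<^sup>2) ^ (k - 1 - l))\<^sup>2"
    for v \<beta> and \<alpha> :: "real^'n" and \<gamma> :: "real^'m"
    unfolding Q_def R_def A_def G_def mpoly_eval_ring mpoly_eval_var mpoly_eval_const norm2 by simp
  \<comment> \<open>A point where \<open>Q\<close> does not vanish: beta = 0 kills every term of
    \<open>R\<close>, and v = C + 1 leaves a power of |alpha|^2, with alpha the all-ones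
    vector.\<close>
  have "(vec 1 :: real^'n) \<noteq> 0" by (simp add: vec_eq_iff)
  then have "mpoly_eval (case_hyp_var (C + 1) (\<lambda>i. (vec 1 :: real^'n) $ i) (\<lambda>j. (0 :: real^'m) $ j) 0) Q \<noteq> 0"
    unfolding eval by simp
  then have "Q \<noteq> 0" by (metis mpoly_eval_zero)
  moreover have "mpoly_eval (case_hyp_var v (\<lambda>i. \<alpha> $ i) (\<lambda>j. \<gamma> $ j) \<beta>) Q = 0"
    if H: "(\<alpha>, \<gamma>) \<noteq> 0" "hyperplane (\<alpha>, \<gamma>) \<beta> \<in> U" "v \<in> volume_values W (hyperplane (\<alpha>, \<gamma>) \<beta>)" for \<alpha> \<gamma> \<beta> v
  proof -
    define N where "N = norm \<alpha>"
    have N: "N \<noteq> 0" using vol[OF H(1,2)] by (simp add: N_def)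
    let ?p = "\<Sum>l<k. \<Sum>i\<le>l. M l i * (norm \<gamma> / N) ^ (2 * i) * (\<beta> / N) ^ (2 * (l - i) + 1)"
    have "(\<Sum>l<k. \<Sum>i\<le>l. M l i * ((norm \<gamma>)\<^sup>2) ^ i * \<beta> ^ (2 * (l - i) + 1) * (N\<^sup>2) ^ (k - 1 - l)) = N ^ (2 * k - 1) * ?p"
      unfolding sum_distrib_left
    proof (intro sum.cong refl)
      fix l i assume "l \<in> {..<k}" "i \<in> {..l}"
      \<comment> \<open>\<open>2 * l + 1\<close> factors \<open>N\<close> clear the denominators of
        the term; the even remainder is the power of \<open>A\<close> in \<open>R\<close>.\<close>
      then have *: "2 * k - 1 = 2 * i + (2 * (l - i) + 1) + 2 * (k - 1 - l)" by auto
      have "N ^ (2 * k - 1) = N ^ (2 * i) * N ^ (2 * (l - i) + 1) * N ^ (2 * (k - 1 - l))"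
        unfolding * power_add by simp
      then show "M l i * ((norm \<gamma>)\<^sup>2) ^ i * \<beta> ^ (2 * (l - i) + 1) * (N\<^sup>2) ^ (k - 1 - l) =
        N ^ (2 * k - 1) * (M l i * (norm \<gamma> / N) ^ (2 * i) * (\<beta> / N) ^ (2 * (l - i) + 1))"
        using N by (simp add: power_divide power_mult[symmetric] del: power_Suc)
    qed
    moreover have "(v - C)\<^sup>2 = ?p\<^sup>2" using vol[OF H(1,2)] H(3) by (simp add: N_def)
    ultimately show ?thesis
      unfolding eval N_def[symmetric]
      by (simp add: power_mult_distrib power_mult[symmetric] mult.commute)
  qed
  ultimately show ?thesis unfolding volume_algebraic_on_def by blast
qed

section \<open>The volume function near the hyperplanes containing the second factor\<close>

theorem mainTheorem2:
  fixes k :: nat and \<epsilon> :: real and W :: "((real^'n) \<times> (real^'m)) set" and C :: real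
  assumes "k \<ge> 1" and "CARD('n) = 2 * k + 1"
    and "0 < \<epsilon>" and "\<epsilon> < 1"
    and W_eq: "W = {(x, y). ((\<Sum>i\<in>UNIV. (x $ i)\<^sup>2) - 1)\<^sup>2 + (\<Sum>j\<in>UNIV. (y $ j)\<^sup>2) \<le> \<epsilon>\<^sup>2}"
    and C_eq: "C = measure lebesgue W"
  shows "\<exists>P :: ab_var mpolynomial.
    total_degree P = 2 * k - 1 \<and>
    (\<forall>e\<in>Poly_Mapping.keys P. even (Poly_Mapping.lookup e VarA) \<and> odd (Poly_Mapping.lookup e VarB)) \<and>
    (\<exists>U. openin hyperplane_topology U \<and>
       {H \<in> hyperplanes. {0} \<times> UNIV \<subseteq> H} \<subseteq> U \<and>
       (\<forall>\<alpha> \<gamma> \<beta>. (\<alpha>, \<gamma>) \<noteq> 0 \<longrightarrow> hyperplane (\<alpha>, \<gamma>) \<beta> \<in> U \<longrightarrow>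
          \<alpha> \<noteq> 0 \<and>
          (let a = sqrt (\<Sum>j\<in>UNIV. (\<gamma> $ j)\<^sup>2) / sqrt (\<Sum>i\<in>UNIV. (\<alpha> $ i)\<^sup>2);
               b = \<bar>\<beta>\<bar> / sqrt (\<Sum>i\<in>UNIV. (\<alpha> $ i)\<^sup>2);
               p = mpoly_eval (case_ab_var a b) P
           in volume_values W (hyperplane (\<alpha>, \<gamma>) \<beta>) = {C / 2 + p, C / 2 - p})) \<and>
       volume_algebraic_on W U)"
proof -
  have norm: "norm x = sqrt (\<Sum>i\<in>UNIV. (x $ i)\<^sup>2)" for x :: "real^'z"
    by (simp add: norm_vec_def L2_set_def)
  have W: "W = tube \<epsilon>" unfolding W_eq tube_def norm by (simp add: sum_nonneg)
  have C: "C = measure lborel (tube \<epsilon> :: ((real^'n) \<times> (real^'m)) set)"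
    unfolding C_eq W by (rule measure_completion) (simp add: closed_tube borel_closed)
  obtain M where M: "M (k - 1) 0 \<noteq> 0"
    and vol: "\<And>(\<alpha>::real^'n) (\<gamma>::real^'m) \<beta>. norm \<alpha> = 1 \<Longrightarrow> norm \<gamma> * \<epsilon> + \<bar>\<beta>\<bar> < sqrt (1 - \<epsilon>) \<Longrightarrow>
      measure lborel (tube \<epsilon> \<inter> {z. (\<alpha>, \<gamma>) \<bullet> z \<le> \<beta>}) = C / 2 +
        (\<Sum>l<k. \<Sum>i\<le>l. M l i * norm \<gamma> ^ (2 * i) * \<beta> ^ (2 * (l - i) + 1))"
    by (rule measure_tube_halfspace[OF assms(1-4), where 'm = 'm, folded C]) blast
  define p where "p a b = (\<Sum>l<k. \<Sum>i\<le>l. M l i * a ^ (2 * i) * b ^ (2 * (l - i) + 1))" for a b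
  have p_minus: "p a (- b) = - p a b" for a b
    unfolding p_def by (rule sum_odd_powers_minus)
  \<comment> \<open>The condition of \<open>vol\<close> for the equation divided by |alpha|,
    multiplied out. It is homogeneous, so it depends on the hyperplane and not on the chosen
    equation.\<close>
  define near where "near = {((\<alpha>::real^'n, \<gamma>::real^'m), \<beta>). norm \<gamma> * \<epsilon> + \<bar>\<beta>\<bar> < norm \<alpha> * sqrt (1 - \<epsilon>)}"
  define U where "U = {hyperplane c b | c b. (c, b) \<in> near}"
  have near_nz: "\<alpha> \<noteq> 0" if "((\<alpha>, \<gamma>), \<beta>) \<in> near" for \<alpha> \<gamma> \<beta>
  proof
    assume "\<alpha> = 0"
    then have "norm \<gamma> * \<epsilon> + \<bar>\<beta>\<bar> < 0" using that by (simp add: near_def)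
    moreover have "0 \<le> norm \<gamma> * \<epsilon>" using assms(3) by simp
    ultimately show False by linarith
  qed
  have near_nz': "c \<noteq> 0" if "(c, b) \<in> near" for c b
    using near_nz[of 0 0 b] that by (auto simp: zero_prod_def)
  have near_scale: "(c', b') \<in> near"
    if near: "(c, b) \<in> near" and nz: "c \<noteq> 0" "c' \<noteq> 0" and eq: "hyperplane c b = hyperplane c' b'" for c c' b b'
  proof -
    obtain t where t: "t \<noteq> 0" "c' = t *\<^sub>R c" "b' = t * b"
      using hyperplane_eq_imp_scaled[OF nz eq] .
    obtain \<alpha> \<gamma> where c: "c = (\<alpha>, \<gamma>)" by (cases c)
    have "\<bar>t\<bar> * (norm \<gamma> * \<epsilon> + \<bar>b\<bar>) < \<bar>t\<bar> * (norm \<alpha> * sqrt (1 - \<epsilon>))"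
      using near t(1) by (intro mult_strict_left_mono) (auto simp: near_def c)
    then show ?thesis by (simp add: near_def t c abs_mult algebra_simps)
  qed
  \<comment> \<open>Thus the preimage of \<open>U\<close> in the space of equations is exactly
    \<open>near\<close>, the set whose openness the quotient topology asks for.\<close>
  have near_iff: "hyperplane c b \<in> U \<longleftrightarrow> (c, b) \<in> near" if "c \<noteq> 0" for c b
  proof
    assume "hyperplane c b \<in> U"
    then obtain c' b' where eq: "hyperplane c b = hyperplane c' b'" and n: "(c', b') \<in> near"
      unfolding U_def by blast
    show "(c, b) \<in> near" using near_scale[OF n near_nz'[OF n] that eq[symmetric]] .
  qed (unfold U_def, blast)
  have "openin hyperplane_topology U"
    unfolding openin_hyperplane_topology
  proof
    show "U \<subseteq> hyperplanes"
      unfolding U_def hyperplanes_def using near_nz' by blast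
    have "{(c, b). c \<noteq> 0 \<and> hyperplane c b \<in> U} = near"
      using near_iff near_nz' by blast
    moreover have "near = {z. norm (snd (fst z)) * \<epsilon> + \<bar>snd z\<bar> < norm (fst (fst z)) * sqrt (1 - \<epsilon>)}"
      by (auto simp: near_def)
    moreover have "open \<dots>" by (intro open_Collect_less continuous_intros)
    ultimately show "open {(c, b). c \<noteq> 0 \<and> hyperplane c b \<in> U}" by simp
  qed
  moreover have "{H \<in> hyperplanes. {0} \<times> UNIV \<subseteq> H} \<subseteq> U"
  proof clarify
    fix H :: "((real^'n) \<times> (real^'m)) set" assume "H \<in> hyperplanes" and sub: "{0} \<times> UNIV \<subseteq> H"
    then obtain \<alpha> \<gamma> \<beta> where H: "H = hyperplane (\<alpha>, \<gamma>) \<beta>" and nz: "(\<alpha>, \<gamma>) \<noteq> 0"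
      unfolding hyperplanes_def by auto
    have y: "\<gamma> \<bullet> y = \<beta>" for y
    proof -
      have "(0, y) \<in> H" using sub by auto
      then show ?thesis by (simp add: H hyperplane_def)
    qed
    have "\<beta> = 0" using y[of 0] by simp
    moreover have "\<gamma> = 0" using y[of \<gamma>] \<open>\<beta> = 0\<close> by simp
    \<comment> \<open>For gamma = 0 and beta = 0 the condition reads 0 < |alpha| sqrt (1 -
      eps).\<close>
    ultimately have "((\<alpha>, \<gamma>), \<beta>) \<in> near" using nz assms(4) by (simp add: near_def zero_prod_def)
    then show "H \<in> U" using near_iff[OF nz] H by simp
  qed
  moreover
  have half: "measure lebesgue (W \<inter> {z. (\<alpha>, \<gamma>) \<bullet> z \<le> \<beta>}) = C / 2 + p (norm \<gamma> / norm \<alpha>) (\<beta> / norm \<alpha>)"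
    if near: "((\<alpha>, \<gamma>), \<beta>) \<in> near" for \<alpha> \<gamma> \<beta>
  proof -
    \<comment> \<open>Dividing the equation by |alpha| keeps the half-space and produces the
      arguments |gamma| / |alpha| and beta / |alpha|.\<close>
    define r where "r = norm \<alpha>"
    have r: "r > 0" using near_nz[OF near] by (simp add: r_def)
    have "norm \<gamma> * \<epsilon> + \<bar>\<beta>\<bar> < r * sqrt (1 - \<epsilon>)" using near by (simp add: near_def r_def)
    then have "norm (\<gamma> /\<^sub>R r) * \<epsilon> + \<bar>\<beta> / r\<bar> < sqrt (1 - \<epsilon>)"
      using r by (simp add: field_simps)
    moreover have "norm (\<alpha> /\<^sub>R r) = 1" using r by (simp add: r_def)
    ultimately have "measure lborel (tube \<epsilon> \<inter> {z. (\<alpha> /\<^sub>R r, \<gamma> /\<^sub>R r) \<bullet> z \<le> \<beta> / r}) = C / 2 + p (norm (\<gamma> /\<^sub>R r)) (\<beta> / r)"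
      unfolding p_def by (intro vol)
    moreover have "{z. (\<alpha> /\<^sub>R r, \<gamma> /\<^sub>R r) \<bullet> z \<le> \<beta> / r} = {z. (\<alpha>, \<gamma>) \<bullet> z \<le> \<beta>}"
    proof -
      have "(\<alpha> /\<^sub>R r, \<gamma> /\<^sub>R r) \<bullet> z = ((\<alpha>, \<gamma>) \<bullet> z) / r" for z
        by (simp add: inner_prod_def divide_inverse algebra_simps)
      then show ?thesis using r by (simp add: divide_le_cancel)
    qed
    moreover have "norm (\<gamma> /\<^sub>R r) = norm \<gamma> / r" using r by (simp add: field_simps)
    moreover have "measure lebesgue (W \<inter> {z. (\<alpha>, \<gamma>) \<bullet> z \<le> \<beta>}) = measure lborel (tube \<epsilon> \<inter> {z. (\<alpha>, \<gamma>) \<bullet> z \<le> \<beta>})"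
      unfolding W
      by (intro measure_completion)
        (auto intro!: borel_closed closed_Int closed_tube closed_Collect_le continuous_intros)
    ultimately show ?thesis by (simp add: r_def)
  qed
  have vol_vals: "volume_values W (hyperplane (\<alpha>, \<gamma>) \<beta>) =
      {C / 2 + p (norm \<gamma> / norm \<alpha>) (\<beta> / norm \<alpha>), C / 2 - p (norm \<gamma> / norm \<alpha>) (\<beta> / norm \<alpha>)}"
    if nz: "(\<alpha>, \<gamma>) \<noteq> 0" and U: "hyperplane (\<alpha>, \<gamma>) \<beta> \<in> U" for \<alpha> \<gamma> \<beta>
  proof -
    have near: "((\<alpha>, \<gamma>), \<beta>) \<in> near" using near_iff[OF nz] U by simp
    \<comment> \<open>The complementary half-space belongs to the negated equation, so the same
      formula applies, with \<open>p\<close> changing sign.\<close>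
    then have "((- \<alpha>, - \<gamma>), - \<beta>) \<in> near" by (simp add: near_def)
    from half[OF this] have "measure lebesgue (W \<inter> {z. (- \<alpha>, - \<gamma>) \<bullet> z \<le> - \<beta>}) =
        C / 2 - p (norm \<gamma> / norm \<alpha>) (\<beta> / norm \<alpha>)" by (simp add: p_minus)
    moreover have "{z. (- \<alpha>, - \<gamma>) \<bullet> z \<le> - \<beta>} = {z. (\<alpha>, \<gamma>) \<bullet> z \<ge> \<beta>}"
      by (auto simp: inner_prod_def)
    ultimately show ?thesis
      using half[OF near] by (simp add: volume_values_hyperplane[OF nz])
  qed
  have "\<alpha> \<noteq> 0 \<and>
          (let a = sqrt (\<Sum>j\<in>UNIV. (\<gamma> $ j)\<^sup>2) / sqrt (\<Sum>i\<in>UNIV. (\<alpha> $ i)\<^sup>2);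
               b = \<bar>\<beta>\<bar> / sqrt (\<Sum>i\<in>UNIV. (\<alpha> $ i)\<^sup>2);
               q = mpoly_eval (case_ab_var a b) (vol_poly k M)
           in volume_values W (hyperplane (\<alpha>, \<gamma>) \<beta>) = {C / 2 + q, C / 2 - q})"
    if nz: "(\<alpha>, \<gamma>) \<noteq> 0" and U: "hyperplane (\<alpha>, \<gamma>) \<beta> \<in> U" for \<alpha> \<gamma> \<beta>
  proof
    show "\<alpha> \<noteq> 0" using near_iff[OF nz] U near_nz by blast
    show "let a = sqrt (\<Sum>j\<in>UNIV. (\<gamma> $ j)\<^sup>2) / sqrt (\<Sum>i\<in>UNIV. (\<alpha> $ i)\<^sup>2);
               b = \<bar>\<beta>\<bar> / sqrt (\<Sum>i\<in>UNIV. (\<alpha> $ i)\<^sup>2);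
               q = mpoly_eval (case_ab_var a b) (vol_poly k M)
           in volume_values W (hyperplane (\<alpha>, \<gamma>) \<beta>) = {C / 2 + q, C / 2 - q}"
      unfolding norm[symmetric] mpoly_eval_vol_poly p_def[symmetric] vol_vals[OF nz U] Let_def
    proof (cases "\<beta> \<ge> 0")
      \<comment> \<open>For negative beta, passing to |beta| exchanges the two elements of the
        set.\<close>
      case False
      then have "\<bar>\<beta>\<bar> / norm \<alpha> = - (\<beta> / norm \<alpha>)" by simp
      then show "{C / 2 + p (norm \<gamma> / norm \<alpha>) (\<beta> / norm \<alpha>), C / 2 - p (norm \<gamma> / norm \<alpha>) (\<beta> / norm \<alpha>)} =
        {C / 2 + p (norm \<gamma> / norm \<alpha>) (\<bar>\<beta>\<bar> / norm \<alpha>), C / 2 - p (norm \<gamma> / norm \<alpha>) (\<bar>\<beta>\<bar> / norm \<alpha>)}"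
        by (simp only: p_minus) auto
    qed simp
  qed
  moreover have "volume_algebraic_on W U"
  proof (rule volume_algebraic_onI[OF assms(1), of U W "C / 2" M])
    fix \<alpha> :: "real^'n" and \<gamma> :: "real^'m" and \<beta> :: real
    assume nz: "(\<alpha>, \<gamma>) \<noteq> 0" and U: "hyperplane (\<alpha>, \<gamma>) \<beta> \<in> U"
    have "\<alpha> \<noteq> 0" using near_iff[OF nz] U near_nz by blast
    then show "\<alpha> \<noteq> 0 \<and> (\<forall>v\<in>volume_values W (hyperplane (\<alpha>, \<gamma>) \<beta>).
        (v - C / 2)\<^sup>2 = (\<Sum>l<k. \<Sum>i\<le>l. M l i * (norm \<gamma> / norm \<alpha>) ^ (2 * i) * (\<beta> / norm \<alpha>) ^ (2 * (l - i) + 1))\<^sup>2)"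
      unfolding vol_vals[OF nz U] p_def[symmetric] by simp
  qed
  moreover have "even (Poly_Mapping.lookup e VarA) \<and> odd (Poly_Mapping.lookup e VarB)"
    if "e \<in> Poly_Mapping.keys (vol_poly k M)" for e
    using that by (rule keys_vol_poly) simp
  ultimately show ?thesis
    using total_degree_vol_poly[of k M, OF assms(1) M] by blast
qed

end
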